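(* Let $\mathbf{k}$ be an arbitrary field, let $S=\mathbf{k}[x_1,\ldots,x_n]$, and let $d\geq 1$ and $t\geq 1$ be integers. Let $I\subset S$ be a pure degree $d$ squarefree monomial ideal with exactly $t$ minimal monomial generators (that is, all $t$ of the minimal monomial generators are squarefree of degree $d$), and let $(t_1,t_2)$ be a nearly even $2$-partition of $t$. Then $$\beta_{2,3d-1}(I) \leq \binom{t}{3} - \binom{t_1}{3} - \binom{t_2}{3}.$$
   Context: For an integer $r$, a nearly even $2$-partition of $r$ is a pair of integers $(r_1,r_2)$ with $r_1+r_2=r$ and $|r_1-r_2|\leq 1$. $S$ carries its standard $\mathbb{Z}$-grading. The graded Betti numbers are those of the ideal $I$ itself as an $S$-module (not of $S/I$): if $$0 \to \bigoplus_{a} S(-a)^{\beta_{l,a}} \to \cdots \to \bigoplus_a S(-a)^{\beta_{0,a}} \to I \to 0$$ is the minimal free $\mathbb{Z}$-graded resolution of $I$, then $\beta_{i,a}(I)=\beta_{i,a}$, with $\beta_{i,a}(I)=0$ for $i$ beyond the length of the resolution. Also $\binom{m}{3}=0$ for $0\le m<3$. *)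

theory Defs
  imports Complex_Main "HOL-Library.Poly_Mapping"
begin

text \<open>
  The polynomial ring \<open>S = k[x\<^sub>1, \<dots>, x\<^sub>n]\<close> is the ring of finitely supported functions from exponent
  vectors to \<open>'k\<close> with the convolution product; the variables are indexed by the finite type
  \<open>'n\<close>, so that \<open>n = CARD('n)\<close>.
\<close>

type_synonym 'n monom = "'n \<Rightarrow>\<^sub>0 nat"
type_synonym ('n, 'k) mpoly = "'n monom \<Rightarrow>\<^sub>0 'k"

definition mon :: "'n monom \<Rightarrow> ('n, 'k::field) mpoly" where
  "mon m = Poly_Mapping.single m 1"

definition mdeg :: "'n::finite monom \<Rightarrow> nat" where
  "mdeg m = (\<Sum>x\<in>UNIV. Poly_Mapping.lookup m x)"

definition ideal_gen :: "('n, 'k::field) mpoly set \<Rightarrow> ('n, 'k) mpoly set" where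
  "ideal_gen = module.span (*)"

definition irrelevant_ideal :: "('n, 'k::field) mpoly set" where
  "irrelevant_ideal = ideal_gen (range (\<lambda>x. mon (Poly_Mapping.single x 1)))"

definition homogeneous :: "int \<Rightarrow> ('n::finite, 'k::field) mpoly \<Rightarrow> bool" where
  "homogeneous c p \<longleftrightarrow> (\<forall>m\<in>Poly_Mapping.keys p. int (mdeg m) = c)"

definition monomial_ideal :: "('n, 'k::field) mpoly set \<Rightarrow> bool" where
  "monomial_ideal I \<longleftrightarrow> (\<exists>A. I = ideal_gen (mon ` A))"

definition min_mon_gens :: "('n, 'k::field) mpoly set \<Rightarrow> 'n monom set" where
  "min_mon_gens I = {m. mon m \<in> I \<and>
     (\<forall>m'. mon m' \<in> I \<longrightarrow> (mon m' :: ('n, 'k) mpoly) dvd mon m \<longrightarrow> m' = m)}"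

definition squarefree_monom :: "'n monom \<Rightarrow> bool" where
  "squarefree_monom m \<longleftrightarrow> (\<forall>x. Poly_Mapping.lookup m x \<le> 1)"

definition pure_squarefree_monomial_ideal ::
    "nat \<Rightarrow> ('n::finite, 'k::field) mpoly set \<Rightarrow> bool" where
  "pure_squarefree_monomial_ideal d I \<longleftrightarrow>
     monomial_ideal I \<and> (\<forall>m\<in>min_mon_gens I. squarefree_monom m \<and> mdeg m = d)"


text \<open>
  For \<open>b :: int \<Rightarrow> nat\<close> the graded free module \<open>\<Oplus>\<^sub>a S(-a)\<^bsup>b a\<^esup>\<close> is realised inside the free module on
  \<open>int \<times> nat\<close>: the basis vector with index \<open>(a, j)\<close>, where \<open>j < b a\<close>, is the generator of the \<open>j\<close>-th
  copy of \<open>S(-a)\<close> and has degree \<open>a\<close>.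
\<close>

type_synonym ('n, 'k) fvec = "(int \<times> nat) \<Rightarrow>\<^sub>0 ('n, 'k) mpoly"

definition smult :: "('n, 'k::field) mpoly \<Rightarrow> ('n, 'k) fvec \<Rightarrow> ('n, 'k) fvec" where
  "smult p v = Poly_Mapping.map ((*) p) v"

definition free_mod :: "(int \<Rightarrow> nat) \<Rightarrow> ('n, 'k::field) fvec set" where
  "free_mod b = {v. Poly_Mapping.keys v \<subseteq> {(a, j). j < b a}}"

text \<open>The component of degree \<open>c\<close>, using \<open>S(-a)\<^sub>c = S\<^bsub>c - a\<^esub>\<close>.\<close>

definition free_mod_comp :: "(int \<Rightarrow> nat) \<Rightarrow> int \<Rightarrow> ('n::finite, 'k::field) fvec set" where
  "free_mod_comp b c =
     {v \<in> free_mod b. \<forall>a j. homogeneous (c - a) (Poly_Mapping.lookup v (a, j))}"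

text \<open>
  The resolution \<open>\<dots> \<rightarrow> F\<^sub>2 \<rightarrow> F\<^sub>1 \<rightarrow> F\<^sub>0 \<rightarrow> I \<rightarrow> 0\<close> with \<open>F\<^sub>i = \<Oplus>\<^sub>a S(-a)\<^bsup>\<beta> i a\<^esup>\<close>, augmentation
  \<open>\<epsilon> : F\<^sub>0 \<rightarrow> I\<close> and differentials \<open>\<phi> i : F\<^bsub>i+1\<^esub> \<rightarrow> F\<^sub>i\<close>. The maps are linear on the whole ambient
  free module, but only their restrictions to the \<open>F\<^sub>i\<close> matter (every linear map on \<open>F\<^sub>i\<close> extends,
  as \<open>F\<^sub>i\<close> is spanned by part of a basis). Minimality is the condition that the image of each
  \<open>\<phi> i\<close> lies in \<open>\<mm> F\<^sub>i\<close>, with \<open>\<mm> = (x\<^sub>1, \<dots>, x\<^sub>n)\<close>.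
\<close>

definition graded_free_resolution ::
    "('n::finite, 'k::field) mpoly set \<Rightarrow> (nat \<Rightarrow> int \<Rightarrow> nat) \<Rightarrow>
     (('n, 'k) fvec \<Rightarrow> ('n, 'k) mpoly) \<Rightarrow> (nat \<Rightarrow> ('n, 'k) fvec \<Rightarrow> ('n, 'k) fvec) \<Rightarrow> bool" where
  "graded_free_resolution I \<beta> \<epsilon> \<phi> \<longleftrightarrow>
     (\<forall>i. finite {a. \<beta> i a \<noteq> 0}) \<and>
     (\<exists>l. \<forall>i>l. \<forall>a. \<beta> i a = 0) \<and>
     module_hom smult (*) \<epsilon> \<and>
     (\<forall>i. module_hom smult smult (\<phi> i)) \<and>
     (\<forall>c. \<forall>v\<in>free_mod_comp (\<beta> 0) c. homogeneous c (\<epsilon> v)) \<and>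
     (\<forall>i c. \<phi> i ` free_mod_comp (\<beta> (Suc i)) c \<subseteq> free_mod_comp (\<beta> i) c) \<and>
     \<epsilon> ` free_mod (\<beta> 0) = I \<and>
     \<phi> 0 ` free_mod (\<beta> 1) = {v \<in> free_mod (\<beta> 0). \<epsilon> v = 0} \<and>
     (\<forall>i. \<phi> (Suc i) ` free_mod (\<beta> (Suc (Suc i))) = {v \<in> free_mod (\<beta> (Suc i)). \<phi> i v = 0})"

definition minimal_graded_free_resolution ::
    "('n::finite, 'k::field) mpoly set \<Rightarrow> (nat \<Rightarrow> int \<Rightarrow> nat) \<Rightarrow>
     (('n, 'k) fvec \<Rightarrow> ('n, 'k) mpoly) \<Rightarrow> (nat \<Rightarrow> ('n, 'k) fvec \<Rightarrow> ('n, 'k) fvec) \<Rightarrow> bool" where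
  "minimal_graded_free_resolution I \<beta> \<epsilon> \<phi> \<longleftrightarrow>
     graded_free_resolution I \<beta> \<epsilon> \<phi> \<and>
     (\<forall>i. \<forall>v\<in>free_mod (\<beta> (Suc i)). \<forall>e. Poly_Mapping.lookup (\<phi> i v) e \<in> irrelevant_ideal)"

text \<open>
  \<open>\<beta> i a\<close> is the graded Betti number \<open>\<beta>\<^bsub>i,a\<^esub>(I)\<close> of the ideal \<open>I\<close> itself (not of \<open>S/I\<close>). The
  minimal resolution is unique up to isomorphism, so \<open>\<beta>\<close> is determined by \<open>I\<close>; it is expressed as
  a relation instead of choosing a resolution.
\<close>

definition graded_betti_numbers ::
    "('n::finite, 'k::field) mpoly set \<Rightarrow> (nat \<Rightarrow> int \<Rightarrow> nat) \<Rightarrow> bool" where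
  "graded_betti_numbers I \<beta> \<longleftrightarrow> (\<exists>\<epsilon> \<phi>. minimal_graded_free_resolution I \<beta> \<epsilon> \<phi>)"


definition nearly_even_2_partition :: "int \<Rightarrow> int \<times> int \<Rightarrow> bool" where
  "nearly_even_2_partition r p \<longleftrightarrow> fst p + snd p = r \<and> \<bar>fst p - snd p\<bar> \<le> 1"

end

(* Over a field k, beta_{2,a}(I) is at most the number of triples of generators whose least common
   multiple has degree a: comparing the minimal resolution with the Taylor complex shows that the
   lifts of the Taylor generators of homological degree 2 span F_2 modulo the irrelevant ideal. If all
   generators are squarefree of degree d, then a triple has least common multiple of degree 3d - 1
   only if exactly one of its three pairs shares a variable. In the graph that joins the
   generators without a common variable these are the triples with exactly two edges, and their number
   is largest for the balanced complete bipartite graph. *)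

theory Submission
  imports Defs
begin

text \<open>The comparison maps from the resolution to the Taylor complex and back compose to a map
  homotopic to the identity. So an element \<open>y\<close> of F_2 differs from a combination of the
  lifts by a boundary \<open>\<phi> 2 z\<close> and a term that the homotopy makes from
  \<open>\<phi> 1 y\<close>. Minimality puts the boundary into \<mm> F_2 and
  \<open>\<phi> 1 y\<close> into \<mm> F_1, and linearity of the homotopy carries the latter into
  \<mm> F_2. This takes exactness of the Taylor complex only at its first two terms, so alternating
  families of polynomials stand in for the whole complex.

  In the graph problem, counting the pairs of an edge and a non-edge at each vertex settles t = 2u
  vertices. For t = 2u + 1 this bound is too large by u when each triple is counted twice: in the
  complete bipartite graph with parts of u and u + 1 vertices, u vertices have degree u + 1, whereas
  degree u would maximise the product of degree and codegree. The odd case has to establish a loss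
  of u for every graph.\<close>

abbreviation lookup where "lookup \<equiv> Poly_Mapping.lookup"
abbreviation keys where "keys \<equiv> Poly_Mapping.keys"

section \<open>Monomials and their ideals\<close>

definition mdvd :: "'n monom \<Rightarrow> 'n monom \<Rightarrow> bool" where
  "mdvd l m \<longleftrightarrow> (\<forall>x. lookup l x \<le> lookup m x)"

definition mlcm :: "'n monom \<Rightarrow> 'n monom \<Rightarrow> 'n monom" where
  "mlcm l m = l + (m - l)"

lemma lookup_mlcm: "lookup (mlcm l m) x = max (lookup l x) (lookup m x)"
  by (simp add: mlcm_def lookup_add lookup_minus)

lemma mlcm_commute: "mlcm l m = mlcm m l"
  by (rule poly_mapping_eqI) (simp add: lookup_mlcm max.commute)

lemma mlcm_left_commute: "mlcm k (mlcm l m) = mlcm l (mlcm k m)"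
  by (rule poly_mapping_eqI) (simp add: lookup_mlcm max.left_commute)

lemma mdvd_refl [simp]: "mdvd m m"
  by (simp add: mdvd_def)

lemma mdvd_add [simp]: "mdvd l (k + l)"
  by (simp add: mdvd_def lookup_add)

lemma mdvd_mlcm [simp]: "mdvd l (mlcm l m)" "mdvd m (mlcm l m)"
  by (simp_all add: mdvd_def lookup_mlcm)

lemma mlcm_mdvd_iff: "mdvd (mlcm k l) m \<longleftrightarrow> mdvd k m \<and> mdvd l m"
  by (auto simp: mdvd_def lookup_mlcm)

lemma mdvd_trans: "mdvd k l \<Longrightarrow> mdvd l m \<Longrightarrow> mdvd k m"
  unfolding mdvd_def using order_trans by blast

lemma mdvd_diff_add: "mdvd l m \<Longrightarrow> (m - l) + l = m"
  by (rule poly_mapping_eqI) (simp add: mdvd_def lookup_add lookup_minus)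

lemma mdeg_add: "mdeg (l + m) = mdeg l + mdeg m"
  by (simp add: mdeg_def lookup_add sum.distrib)

lemma mdeg_zero [simp]: "mdeg 0 = 0"
  by (simp add: mdeg_def)

lemma mdvd_mdeg_less:
  assumes "mdvd l m" "l \<noteq> m"
  shows "mdeg l < mdeg m"
proof -
  obtain x where "lookup l x \<noteq> lookup m x"
    using assms(2) by (meson poly_mapping_eqI)
  with assms(1) show ?thesis
    unfolding mdeg_def mdvd_def by (intro sum_strict_mono_ex1) (auto intro!: bexI[of _ x] le_neq_trans)
qed

lemma mon_mult: "(mon l :: ('n, 'k::field) mpoly) * mon m = mon (l + m)"
  by (simp add: mon_def mult_single)

lemma mon_diff_mult: "mdvd l m \<Longrightarrow> (mon (m - l) :: ('n, 'k::field) mpoly) * mon l = mon m"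
  by (simp add: mon_mult mdvd_diff_add)

lemma poly_mapping_sum_single:
  "(\<Sum>k\<in>keys p. Poly_Mapping.single k (lookup p k)) = p"
proof (rule poly_mapping_eqI)
  fix k
  have "lookup (\<Sum>k\<in>keys p. Poly_Mapping.single k (lookup p k)) k
      = (\<Sum>l\<in>keys p. if l = k then lookup p l else 0)"
    by (simp add: lookup_sum lookup_single when_def)
  also have "\<dots> = lookup p k"
    by (simp add: in_keys_iff)
  finally show "lookup (\<Sum>k\<in>keys p. Poly_Mapping.single k (lookup p k)) k = lookup p k" .
qed

text \<open>Single terms generate the finitely supported functions additively. Only terms in the
  support of \<open>p\<close> are asked for, so a hypothesis on \<open>keys p\<close> can be used
  term by term.\<close>

lemma additive_poly_mapping_eqI:
  assumes "\<And>p q. F (p + q) = F p + F q" "\<And>p q. G (p + q) = G p + G q"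
    and "\<And>k c. k \<in> keys p \<Longrightarrow> F (Poly_Mapping.single k c) = G (Poly_Mapping.single k c)"
  shows "F (p :: 'a \<Rightarrow>\<^sub>0 'b::ab_group_add) = (G p :: 'c::ab_group_add)"
proof -
  interpret F: additive F by standard (rule assms)
  interpret G: additive G by standard (rule assms)
  have "F (\<Sum>k\<in>keys p. Poly_Mapping.single k (lookup p k))
      = G (\<Sum>k\<in>keys p. Poly_Mapping.single k (lookup p k))"
    unfolding F.sum G.sum by (intro sum.cong assms refl)
  thus ?thesis by (simp add: poly_mapping_sum_single)
qed

text \<open>Division by a monomial which drops the terms that are not divisible.\<close>

definition mdiv :: "('n, 'k::field) mpoly \<Rightarrow> 'n monom \<Rightarrow> ('n, 'k) mpoly" where
  "mdiv p l = Poly_Mapping.map_key (\<lambda>m. m + l) p"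

lemma lookup_mdiv: "lookup (mdiv p l) m = lookup p (m + l)"
  unfolding mdiv_def by (subst Poly_Mapping.map_key.rep_eq) (auto intro: injI)

lemma mdiv_add: "mdiv (p + q) l = mdiv p l + mdiv q l"
  by (rule poly_mapping_eqI) (simp add: lookup_mdiv lookup_add)

lemma mdiv_uminus: "mdiv (- p) l = - mdiv p l"
  by (rule poly_mapping_eqI) (simp add: lookup_mdiv)

lemma mdiv_zero [simp]: "mdiv 0 l = 0"
  by (rule poly_mapping_eqI) (simp add: lookup_mdiv)

lemma mdiv_sum: "mdiv (sum f A) l = (\<Sum>a\<in>A. mdiv (f a) l)"
  by (rule poly_mapping_eqI) (simp add: lookup_mdiv lookup_sum)

lemma mdiv_mult_mon [simp]: "mdiv (p * mon l) l = (p :: ('n, 'k::field) mpoly)"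
proof (rule additive_poly_mapping_eqI[where F = "\<lambda>p. mdiv (p * mon l) l" and G = "\<lambda>p. p"])
  fix k :: "'n monom" and c :: 'k
  show "mdiv (Poly_Mapping.single k c * mon l) l = Poly_Mapping.single k c"
    by (rule poly_mapping_eqI) (auto simp: mon_def mult_single lookup_mdiv lookup_single when_def)
qed (simp_all add: mdiv_add algebra_simps)

lemma mdiv_mult_mon_cancel:
  assumes "keys p \<subseteq> {m. mdvd l m}"
  shows "mdiv p l * mon l = (p :: ('n, 'k::field) mpoly)"
proof (rule additive_poly_mapping_eqI[where F = "\<lambda>p. mdiv p l * mon l" and G = "\<lambda>p. p"])
  fix k :: "'n monom" and c :: 'k
  assume "k \<in> keys p"
  with assms have k: "k = (k - l) + l"
    by (auto simp: mdvd_diff_add)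
  have "Poly_Mapping.single k c = Poly_Mapping.single (k - l) c * mon l"
    by (simp add: mon_def mult_single flip: k)
  thus "mdiv (Poly_Mapping.single k c) l * mon l = Poly_Mapping.single k c"
    by simp
qed (simp_all add: mdiv_add algebra_simps)

lemma keys_mult_mon: "keys ((p :: ('n, 'k::field) mpoly) * mon l) \<subseteq> {m. mdvd l m}"
  using keys_mult[of p "mon l"] by (auto simp: mon_def)

lemma mdiv_mult_mon_add:
  "mdvd k l \<Longrightarrow> mdiv (p * mon l) k = (p :: ('n, 'k::field) mpoly) * mon (l - k)"
  using mdiv_mult_mon[of "p * mon (l - k)" k] by (simp add: mon_diff_mult mult.assoc)

lemma mon_dvd_mon_iff: "(mon l :: ('n, 'k::field) mpoly) dvd mon m \<longleftrightarrow> mdvd l m"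
proof
  assume "(mon l :: ('n, 'k) mpoly) dvd mon m"
  then obtain p :: "('n, 'k) mpoly" where p: "mon m = p * mon l"
    by (metis dvdE mult.commute)
  have "m \<in> keys (mon m :: ('n, 'k) mpoly)"
    by (simp add: mon_def)
  with keys_mult_mon[of p l] show "mdvd l m"
    by (auto simp: p)
next
  assume "mdvd l m"
  hence "(mon m :: ('n, 'k) mpoly) = mon (m - l) * mon l"
    by (simp add: mon_diff_mult)
  thus "(mon l :: ('n, 'k) mpoly) dvd mon m"
    by simp
qed

lemma monom_add_eq_0_iff: "(l :: 'n monom) + m = 0 \<longleftrightarrow> l = 0 \<and> m = 0"
  by (auto simp: poly_mapping_eq_iff fun_eq_iff lookup_add)

text \<open>Two exponent vectors add up to zero only if both are zero. The constant coefficient is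
  thus the ring map from S to S / \<mm> = k.\<close>

lemma lookup_mult_zero:
  "lookup ((p :: ('n, 'k::field) mpoly) * q) 0 = lookup p 0 * lookup q 0"
proof (rule additive_poly_mapping_eqI[where F = "\<lambda>p. lookup (p * q) 0"
      and G = "\<lambda>p. lookup p 0 * lookup q 0"])
  fix k :: "'n monom" and c :: 'k
  show "lookup (Poly_Mapping.single k c * q) 0 = lookup (Poly_Mapping.single k c) 0 * lookup q 0"
  proof (rule additive_poly_mapping_eqI[where F = "\<lambda>q. lookup (Poly_Mapping.single k c * q) 0"
        and G = "\<lambda>q. lookup (Poly_Mapping.single k c) 0 * lookup q 0"])
    fix k' :: "'n monom" and c' :: 'k
    show "lookup (Poly_Mapping.single k c * Poly_Mapping.single k' c') 0
        = lookup (Poly_Mapping.single k c) 0 * lookup (Poly_Mapping.single k' c') 0"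
      by (auto simp: mult_single lookup_single when_def monom_add_eq_0_iff)
  qed (simp_all add: lookup_add algebra_simps)
qed (simp_all add: lookup_add algebra_simps)

interpretation mpoly: module "(*) :: ('n, 'k::field) mpoly \<Rightarrow> _"
  by standard (simp_all add: algebra_simps)

lemma mon_ideal: "p * mon l \<in> ideal_gen (mon ` A)" if "l \<in> A"
  for p :: "('n, 'k::field) mpoly"
  unfolding ideal_gen_def using that by (intro mpoly.span_scale mpoly.span_base) auto

text \<open>Translates minimality of a resolution into vanishing constant coefficients.\<close>

lemma irrelevant_ideal_lookup_zero:
  "(p :: ('n, 'k::field) mpoly) \<in> irrelevant_ideal \<Longrightarrow> lookup p 0 = 0"
  unfolding irrelevant_ideal_def ideal_gen_def
proof (induct rule: mpoly.span_induct_alt)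
  case (step c x y)
  have "Poly_Mapping.single x (1 :: nat) \<noteq> 0" for x :: 'n
    by (metis lookup_single_eq lookup_zero zero_neq_one)
  with step show ?case
    by (auto simp: lookup_add lookup_mult_zero mon_def lookup_single when_def)
qed simp

lemma monomial_ideal_representation:
  fixes I :: "('n::finite, 'k::field) mpoly set"
  assumes "monomial_ideal I" "p \<in> I" "finite (min_mon_gens I)"
  obtains u where "p = (\<Sum>m\<in>min_mon_gens I. u m * mon m)"
proof -
  let ?G = "min_mon_gens I"
  obtain A where A: "I = ideal_gen (mon ` A)"
    using assms(1) by (auto simp: monomial_ideal_def)
  let ?X = "{p. \<exists>u. p = (\<Sum>m\<in>?G. u m * mon m)} :: ('n, 'k) mpoly set"
  have "mpoly.subspace ?X"
  proof (rule mpoly.subspaceI)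
    show "0 \<in> ?X" by (auto intro!: exI[of _ "\<lambda>_. 0"])
  next
    fix x y assume "x \<in> ?X" "y \<in> ?X"
    then obtain u v where "x = (\<Sum>m\<in>?G. u m * mon m)" "y = (\<Sum>m\<in>?G. v m * mon m)" by auto
    hence "x + y = (\<Sum>m\<in>?G. (u m + v m) * mon m)"
      by (simp add: sum.distrib distrib_right)
    thus "x + y \<in> ?X" by (intro CollectI exI[of _ "\<lambda>m. u m + v m"])
  next
    fix c x assume "x \<in> ?X"
    then obtain u where "x = (\<Sum>m\<in>?G. u m * mon m)" by auto
    hence "c * x = (\<Sum>m\<in>?G. (c * u m) * mon m)"
      by (simp only: sum_distrib_left mult.assoc)
    thus "c * x \<in> ?X" by (intro CollectI exI[of _ "\<lambda>m. c * u m"])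
  qed
  moreover have "mon ` A \<subseteq> ?X"
  proof safe
    fix a assume "a \<in> A"
    hence "mdvd a a \<and> mon a \<in> I"
      using mon_ideal[of a A "1 :: ('n, 'k) mpoly"] by (simp add: A)
    \<comment> \<open>Among the divisors of \<open>a\<close> that lie in \<open>I\<close>, one of
      least degree has no proper divisor in \<open>I\<close>, so it is a minimal generator.\<close>
    then obtain m where m: "mdvd m a" "mon m \<in> I"
      and min: "\<And>l. mdeg l < mdeg m \<Longrightarrow> \<not> (mdvd l a \<and> mon l \<in> I)"
      using exists_least_iff[of "\<lambda>d. \<exists>m. mdeg m = d \<and> mdvd m a \<and> mon m \<in> I"] by metis
    have "m \<in> ?G"
      unfolding min_mon_gens_def mon_dvd_mon_iff
      using m min mdvd_mdeg_less mdvd_trans by blast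
    have "(mon a :: ('n, 'k) mpoly) = (\<Sum>l\<in>?G. if l = m then mon (a - m) * mon m else 0)"
      using assms(3) \<open>m \<in> ?G\<close> by (simp add: mon_diff_mult m)
    also have "\<dots> = (\<Sum>l\<in>?G. (if l = m then mon (a - m) else 0) * mon l)"
      by (intro sum.cong) auto
    finally show "\<exists>u. (mon a :: ('n, 'k) mpoly) = (\<Sum>m\<in>?G. u m * mon m)"
      by (rule exI[of _ "\<lambda>l. if l = m then mon (a - m) else 0"])
  qed
  ultimately have "I \<subseteq> ?X"
    unfolding A ideal_gen_def by (intro mpoly.span_minimal)
  with assms(2) that show thesis by auto
qed

section \<open>Exactness of the Taylor complex in low degrees\<close>

definition restr :: "('a \<Rightarrow> bool) \<Rightarrow> ('a \<Rightarrow>\<^sub>0 'b::zero) \<Rightarrow> 'a \<Rightarrow>\<^sub>0 'b" where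
  "restr P p = Poly_Mapping.mapp (\<lambda>k c. c when P k) p"

lemma lookup_restr: "lookup (restr P p) k = (lookup p k when P k)"
  by (auto simp: restr_def lookup_mapp when_def in_keys_iff)

lemma restr_add: "restr P (p + q) = restr P p + restr P (q :: 'a \<Rightarrow>\<^sub>0 'b::monoid_add)"
  by (rule poly_mapping_eqI) (simp add: lookup_restr lookup_add when_def)

lemma restr_uminus: "restr P (- p) = - restr P (p :: 'a \<Rightarrow>\<^sub>0 'b::ab_group_add)"
  by (rule poly_mapping_eqI) (simp add: lookup_restr when_def)

lemma restr_zero [simp]: "restr P 0 = 0"
  by (rule poly_mapping_eqI) (simp add: lookup_restr)

lemma restr_sum: "restr P (sum f A) = (\<Sum>a\<in>A. restr P (f a :: 'a \<Rightarrow>\<^sub>0 'b::comm_monoid_add))"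
  by (rule poly_mapping_eqI) (simp add: lookup_restr lookup_sum when_def)

lemma sum_restr_fibres:
  fixes p :: "'a \<Rightarrow>\<^sub>0 'b::comm_monoid_add"
  assumes "finite A" "\<And>k. k \<in> keys p \<Longrightarrow> g k \<in> A"
  shows "(\<Sum>a\<in>A. restr (\<lambda>k. g k = a) p) = p"
proof (rule poly_mapping_eqI)
  fix k
  show "lookup (\<Sum>a\<in>A. restr (\<lambda>k. g k = a) p) k = lookup p k"
    using assms by (cases "k \<in> keys p") (simp_all add: lookup_sum lookup_restr when_def in_keys_iff)
qed

text \<open>The term \<open>S(-L\<^sub>\<sigma>)\<close> of the Taylor complex, where \<open>L\<^sub>\<sigma>\<close> is the least common multiple of the
  monomials in \<open>\<sigma>\<close>, is identified with the ideal \<open>(x\<^sup>L\<^sup>\<sigma>)\<close>, so that the boundary maps become signed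
  inclusions. A chain is an alternating family of elements of these ideals. The contracting
  homotopy inserts a chosen index \<open>g \<mu>\<close> with \<open>m (g \<mu>)\<close> dividing \<open>\<mu>\<close>.\<close>

lemma taylor_exact_0:
  fixes U :: "nat \<Rightarrow> ('n, 'k::field) mpoly"
  assumes "\<And>i. i < t \<Longrightarrow> keys (U i) \<subseteq> {\<mu>. mdvd (m i) \<mu>}" "(\<Sum>i<t. U i) = 0"
  obtains Q where "\<And>i j. Q j i = - Q i j" "\<And>i. Q i i = 0"
    "\<And>i j. i < t \<Longrightarrow> j < t \<Longrightarrow> keys (Q i j) \<subseteq> {\<mu>. mdvd (m i) \<mu> \<and> mdvd (m j) \<mu>}"
    "\<And>i. i < t \<Longrightarrow> (\<Sum>a<t. Q a i) = U i"
proof -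
  \<comment> \<open>The inserted index depends on the monomial alone, so the same restriction
    applies to every \<open>U i\<close>. Monomials divisible by no \<open>m a\<close> get an
    arbitrary value, but do not occur in any \<open>U i\<close> with \<open>i < t\<close>.\<close>
  define g where "g \<mu> = (SOME a. a < t \<and> mdvd (m a) \<mu>)" for \<mu>
  have g: "g \<mu> < t \<and> mdvd (m (g \<mu>)) \<mu>" if "i < t" "mdvd (m i) \<mu>" for i \<mu>
    unfolding g_def using that by (intro someI_ex[of "\<lambda>a. a < t \<and> mdvd (m a) \<mu>"]) auto
  let ?R = "\<lambda>a. restr (\<lambda>\<mu>. g \<mu> = a)"
  have R: "keys (?R a (U i)) \<subseteq> {\<mu>. mdvd (m a) \<mu> \<and> mdvd (m i) \<mu>}" if "i < t" for a i
  proof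
    fix \<mu> assume "\<mu> \<in> keys (?R a (U i))"
    hence "\<mu> \<in> keys (U i)" "g \<mu> = a"
      by (auto simp: in_keys_iff lookup_restr when_def split: if_splits)
    thus "\<mu> \<in> {\<mu>. mdvd (m a) \<mu> \<and> mdvd (m i) \<mu>}"
      using g[OF that, of \<mu>] subsetD[OF assms(1)[OF that], of \<mu>] by simp
  qed
  show thesis
  \<comment> \<open>When the first index is summed, the first term gives back the chain, and the
    second is a restriction of the vanishing total sum.\<close>
  proof (rule that[of "\<lambda>i j. ?R i (U j) - ?R j (U i)"])
    fix i j assume "i < t" "j < t"
    thus "keys (?R i (U j) - ?R j (U i)) \<subseteq> {\<mu>. mdvd (m i) \<mu> \<and> mdvd (m j) \<mu>}"
      using R[of j i] R[of i j] keys_diff[of "?R i (U j)" "?R j (U i)"] by blast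
  next
    fix i assume i: "i < t"
    have "(\<Sum>a<t. ?R a (U i)) = U i"
      using g[OF i] assms(1)[OF i] by (intro sum_restr_fibres) auto
    thus "(\<Sum>a<t. ?R a (U i) - ?R i (U a)) = U i"
      by (simp add: sum_subtractf assms(2) flip: restr_sum)
  qed simp_all
qed

text \<open>The same inserted index serves one degree higher. The cyclic sum over three indices
  makes the lift alternating. Summed over \<open>a\<close>, its first term gives
  \<open>p i j\<close>, and the other two become restrictions of cycle sums, hence zero. Vanishing
  on repeated indices is recorded separately, since in characteristic two it does not follow from
  the sign rule.\<close>

lemma taylor_exact_1:
  fixes p :: "nat \<Rightarrow> nat \<Rightarrow> ('n, 'k::field) mpoly"
  assumes "\<And>i j. p j i = - p i j" "\<And>i. p i i = 0"
    and keys: "\<And>i j. i < t \<Longrightarrow> j < t \<Longrightarrow> keys (p i j) \<subseteq> {\<mu>. mdvd (m i) \<mu> \<and> mdvd (m j) \<mu>}"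
    and cycle: "\<And>j. j < t \<Longrightarrow> (\<Sum>a<t. p a j) = 0"
  obtains A where "\<And>a i j. A i a j = - A a i j" "\<And>a i j. A a j i = - A a i j"
    "\<And>i j. A i i j = 0" "\<And>i j. A i j j = 0"
    "\<And>a i j. a < t \<Longrightarrow> i < t \<Longrightarrow> j < t \<Longrightarrow>
      keys (A a i j) \<subseteq> {\<mu>. mdvd (m a) \<mu> \<and> mdvd (m i) \<mu> \<and> mdvd (m j) \<mu>}"
    "\<And>i j. i < t \<Longrightarrow> j < t \<Longrightarrow> (\<Sum>a<t. A a i j) = p i j"
proof -
  define g where "g \<mu> = (SOME a. a < t \<and> mdvd (m a) \<mu>)" for \<mu>
  have g: "g \<mu> < t \<and> mdvd (m (g \<mu>)) \<mu>" if "i < t" "mdvd (m i) \<mu>" for i \<mu>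
    unfolding g_def using that by (intro someI_ex[of "\<lambda>a. a < t \<and> mdvd (m a) \<mu>"]) auto
  let ?R = "\<lambda>a. restr (\<lambda>\<mu>. g \<mu> = a)"
  let ?A = "\<lambda>a i j. ?R a (p i j) + ?R i (p j a) + ?R j (p a i)"
  have R: "keys (?R a (p i j)) \<subseteq> {\<mu>. mdvd (m a) \<mu> \<and> mdvd (m i) \<mu> \<and> mdvd (m j) \<mu>}"
    if "i < t" "j < t" for a i j
  proof
    fix \<mu> assume "\<mu> \<in> keys (?R a (p i j))"
    hence "\<mu> \<in> keys (p i j)" "g \<mu> = a"
      by (auto simp: in_keys_iff lookup_restr when_def split: if_splits)
    thus "\<mu> \<in> {\<mu>. mdvd (m a) \<mu> \<and> mdvd (m i) \<mu> \<and> mdvd (m j) \<mu>}"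
      using g[OF that(1), of \<mu>] subsetD[OF keys[OF that], of \<mu>] by simp
  qed
  have cycle': "(\<Sum>a<t. p j a) = 0" if "j < t" for j
    using cycle[OF that] by (subst assms(1)) (simp add: sum_negf)
  show thesis
  proof (rule that[of ?A])
    fix a i j
    show "?A i a j = - ?A a i j"
      by (simp add: assms(1)[of i j] assms(1)[of j a] assms(1)[of a i] restr_uminus)
    show "?A a j i = - ?A a i j"
      by (simp add: assms(1)[of i j] assms(1)[of j a] assms(1)[of a i] restr_uminus)
    assume "a < t" "i < t" "j < t"
    thus "keys (?A a i j) \<subseteq> {\<mu>. mdvd (m a) \<mu> \<and> mdvd (m i) \<mu> \<and> mdvd (m j) \<mu>}"
      using R[of i j a] R[of j a i] R[of a i j] keys_add[of "?R a (p i j)" "?R i (p j a)"]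
        keys_add[of "?R a (p i j) + ?R i (p j a)" "?R j (p a i)"] by blast
  next
    fix i j
    show "?A i i j = 0" "?A i j j = 0"
      by (simp_all add: assms(1)[of j i] assms(2) restr_uminus)
  next
    fix i j assume ij: "i < t" "j < t"
    have "(\<Sum>a<t. ?R a (p i j)) = p i j"
      using g[OF ij(1)] keys[OF ij] by (intro sum_restr_fibres) auto
    thus "(\<Sum>a<t. ?A a i j) = p i j"
      by (simp add: sum.distrib ij cycle cycle' flip: restr_sum)
  qed
qed

section \<open>Graded free modules\<close>

lemma lookup_smult: "lookup (smult p v) e = p * lookup v e"
  by (simp add: smult_def map.rep_eq when_def)

interpretation fvec: module "smult :: ('n, 'k::field) mpoly \<Rightarrow> _"
proof
  fix a b :: "('n, 'k) mpoly" and x y :: "('n, 'k) fvec"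
  show "smult a (x + y) = smult a x + smult a y"
    by (rule poly_mapping_eqI) (simp only: lookup_smult lookup_add distrib_left)
  show "smult (a + b) x = smult a x + smult b x"
    by (rule poly_mapping_eqI) (simp only: lookup_smult lookup_add distrib_right)
  show "smult a (smult b x) = smult (a * b) x"
    by (rule poly_mapping_eqI) (simp only: lookup_smult mult.assoc)
  show "smult 1 x = x"
    by (rule poly_mapping_eqI) (simp only: lookup_smult mult_1)
qed

interpretation fvec_mpoly: module_pair "smult :: ('n, 'k::field) mpoly \<Rightarrow> _"
    "(*) :: ('n, 'k) mpoly \<Rightarrow> _"
  by (rule module_pair.intro) (rule fvec.module_axioms mpoly.module_axioms)+

interpretation fvec_fvec: module_pair "smult :: ('n, 'k::field) mpoly \<Rightarrow> _"
    "smult :: ('n, 'k) mpoly \<Rightarrow> _"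
  by (rule module_pair.intro) (rule fvec.module_axioms)+

lemma free_mod_iff: "v \<in> free_mod b \<longleftrightarrow> (\<forall>e. snd e \<ge> b (fst e) \<longrightarrow> lookup v e = 0)"
  unfolding free_mod_def subset_iff by (simp add: in_keys_iff split_beta) (metis not_le)

lemma subspace_free_mod: "fvec.subspace (free_mod b)"
  by (rule fvec.subspaceI) (auto simp: free_mod_iff lookup_add lookup_smult)

lemma free_mod_comp_subset: "v \<in> free_mod_comp b c \<Longrightarrow> v \<in> free_mod b"
  by (simp add: free_mod_comp_def)

lemma homogeneous_iff: "homogeneous c p \<longleftrightarrow> (\<forall>m. int (mdeg m) \<noteq> c \<longrightarrow> lookup p m = 0)"
  by (auto simp: homogeneous_def in_keys_iff)

lemma homogeneous_diff: "homogeneous c p \<Longrightarrow> homogeneous c q \<Longrightarrow> homogeneous c (p - q)"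
  by (auto simp: homogeneous_iff lookup_minus)

lemma homogeneous_add: "homogeneous c p \<Longrightarrow> homogeneous c q \<Longrightarrow> homogeneous c (p + q)"
  by (auto simp: homogeneous_iff lookup_add)

lemma homogeneous_mon_mult:
  assumes "homogeneous c p"
  shows "homogeneous (c + int (mdeg l)) (mon l * p)"
  unfolding homogeneous_def
proof
  fix m assume "m \<in> keys (mon l * p)"
  then obtain k where "k \<in> keys p" "m = l + k"
    using keys_mult[of "mon l" p] by (auto simp: mon_def split: if_splits)
  with assms show "int (mdeg m) = c + int (mdeg l)"
    by (auto simp: homogeneous_def mdeg_add)
qed

lemma free_mod_comp_add:
  "v \<in> free_mod_comp b c \<Longrightarrow> w \<in> free_mod_comp b c \<Longrightarrow> v + w \<in> free_mod_comp b c"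
  by (auto simp: free_mod_comp_def lookup_add homogeneous_add fvec.subspace_add[OF subspace_free_mod])

lemma free_mod_comp_diff:
  "v \<in> free_mod_comp b c \<Longrightarrow> w \<in> free_mod_comp b c \<Longrightarrow> v - w \<in> free_mod_comp b c"
  by (auto simp: free_mod_comp_def lookup_minus homogeneous_diff fvec.subspace_diff[OF subspace_free_mod])

lemma free_mod_comp_mon_smult:
  assumes "v \<in> free_mod_comp b (int (mdeg k))" "mdvd k l"
  shows "smult (mon (l - k)) v \<in> free_mod_comp b (int (mdeg l))"
proof -
  have deg: "int (mdeg l) - a = (int (mdeg k) - a) + int (mdeg (l - k))" for a
    using mdeg_add[of "l - k" k] mdvd_diff_add[OF assms(2)] by simp
  show ?thesis
    using assms(1) unfolding free_mod_comp_def mem_Collect_eq lookup_smult deg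
    by (intro conjI allI homogeneous_mon_mult fvec.subspace_scale[OF subspace_free_mod]) auto
qed

section \<open>Homogeneous components and graded maps\<close>

definition hcomp :: "int \<Rightarrow> ('n::finite, 'k::field) fvec \<Rightarrow> ('n, 'k) fvec" where
  "hcomp c v = Poly_Mapping.mapp (\<lambda>e. restr (\<lambda>m. int (mdeg m) = c - fst e)) v"

lemma lookup_hcomp: "lookup (hcomp c v) e = restr (\<lambda>m. int (mdeg m) = c - fst e) (lookup v e)"
  by (auto simp: hcomp_def lookup_mapp when_def in_keys_iff)

lemma hcomp_add: "hcomp c (v + w) = hcomp c v + hcomp c w"
  by (rule poly_mapping_eqI) (simp add: lookup_hcomp lookup_add restr_add)

lemma hcomp_in_free_mod_comp: "v \<in> free_mod b \<Longrightarrow> hcomp c v \<in> free_mod_comp b c"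
  by (auto simp: free_mod_comp_def free_mod_iff lookup_hcomp homogeneous_iff lookup_restr when_def
      split: if_splits)

lemma restr_homogeneous:
  "homogeneous c p \<Longrightarrow> restr (\<lambda>m. int (mdeg m) = c') p = (if c' = c then p else 0)"
  by (rule poly_mapping_eqI) (auto simp: homogeneous_iff lookup_restr when_def)

lemma hcomp_free_mod_comp:
  "v \<in> free_mod_comp b c \<Longrightarrow> hcomp c' v = (if c' = c then v else 0)"
proof (rule poly_mapping_eqI)
  fix e assume v: "v \<in> free_mod_comp b c"
  have "homogeneous (c - fst e) (lookup v e)"
    using v by (cases e) (simp add: free_mod_comp_def)
  from restr_homogeneous[OF this, of "c' - fst e"]
  show "lookup (hcomp c' v) e = lookup (if c' = c then v else 0) e"
    by (simp add: lookup_hcomp)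
qed

lemma sum_hcomp:
  obtains C where "finite C" "(\<Sum>c\<in>C. hcomp c v) = v"
proof -
  let ?C = "(\<lambda>(e, m). fst e + int (mdeg m)) ` (SIGMA e : keys v. keys (lookup v e))"
  have "(\<Sum>c\<in>?C. hcomp c v) = v"
  proof (intro poly_mapping_eqI)
    fix e m
    have "lookup (lookup (\<Sum>c\<in>?C. hcomp c v) e) m
        = (\<Sum>c\<in>?C. if fst e + int (mdeg m) = c then lookup (lookup v e) m else 0)"
      unfolding lookup_sum lookup_hcomp lookup_restr by (intro sum.cong) (auto simp: when_def)
    also have "\<dots> = lookup (lookup v e) m"
    proof (cases "lookup (lookup v e) m = 0")
      case False
      hence "fst e + int (mdeg m) \<in> ?C"
        by (force simp: in_keys_iff)
      thus ?thesis by simp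
    qed simp
    finally show "lookup (lookup (\<Sum>c\<in>?C. hcomp c v) e) m = lookup (lookup v e) m" .
  qed
  thus thesis by (intro that[of ?C]) auto
qed

text \<open>The projection \<open>proj\<close> is abstract because the target is the polynomial ring
  for \<open>\<epsilon>\<close> and a free module for \<open>\<phi> i\<close>. Apply
  \<open>proj c\<close> to the images of the components of \<open>v\<close>: all but the one of
  degree \<open>c\<close> are killed.\<close>

lemma graded_map_hcomp:
  fixes F :: "('n::finite, 'k::field) fvec \<Rightarrow> 'a::ab_group_add" and proj :: "int \<Rightarrow> 'a \<Rightarrow> 'a"
  assumes "additive F" "\<And>c. additive (proj c)"
    and proj: "\<And>c c' v. v \<in> free_mod_comp b c \<Longrightarrow> proj c' (F v) = (if c' = c then F v else 0)"
    and v: "v \<in> free_mod b"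
  shows "F (hcomp c v) = proj c (F v)"
proof -
  interpret F: additive F by fact
  interpret P: additive "proj c" by fact
  obtain C where C: "finite C" "(\<Sum>c\<in>C. hcomp c v) = v"
    by (rule sum_hcomp)
  \<comment> \<open>\<open>C\<close> is only known to sum up to \<open>v\<close>. Taking the
    component of degree \<open>c\<close> of that sum shows that no degree is missing from
    it.\<close>
  have "hcomp c v = 0" if "c \<notin> C"
  proof -
    interpret h: additive "hcomp c" by standard (rule hcomp_add)
    have "hcomp c v = (\<Sum>c'\<in>C. hcomp c (hcomp c' v))"
      using C(2) h.sum[of "\<lambda>c. hcomp c v" C] by simp
    also have "\<dots> = 0"
      using that by (intro sum.neutral) (auto simp: hcomp_free_mod_comp[OF hcomp_in_free_mod_comp[OF v]])
    finally show ?thesis .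
  qed
  hence "F (hcomp c v) = (\<Sum>c'\<in>C. if c = c' then F (hcomp c' v) else 0)"
    using C(1) by (simp add: F.zero)
  also have "\<dots> = (\<Sum>c'\<in>C. proj c (F (hcomp c' v)))"
    using v by (intro sum.cong) (simp_all add: proj[OF hcomp_in_free_mod_comp])
  also have "\<dots> = proj c (F v)"
    unfolding P.sum[symmetric] F.sum[symmetric] C(2) ..
  finally show ?thesis .
qed

section \<open>Linear maps prescribed on a basis\<close>

definition lext :: "(('n, 'k::field) mpoly \<Rightarrow> 'a \<Rightarrow> 'a::ab_group_add) \<Rightarrow>
    (int \<times> nat \<Rightarrow> 'a) \<Rightarrow> ('n, 'k) fvec \<Rightarrow> 'a" where
  "lext scale f v = (\<Sum>e\<in>keys v. scale (lookup v e) (f e))"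

abbreviation unit_vec :: "int \<times> nat \<Rightarrow> ('n, 'k::field) fvec" where
  "unit_vec e \<equiv> Poly_Mapping.single e 1"

lemma lext_superset:
  assumes "module scale" "finite A" "keys v \<subseteq> A"
  shows "lext scale f v = (\<Sum>e\<in>A. scale (lookup v e) (f e))"
  unfolding lext_def using assms
  by (intro sum.mono_neutral_left) (auto simp: in_keys_iff module.scale_zero_left)

lemma module_hom_lext:
  assumes "module scale"
  shows "module_hom smult scale (lext scale f)"
proof -
  interpret module scale by fact
  have "lext scale f (v + w) = lext scale f v + lext scale f w" for v w
    using keys_add[of v w]
    by (simp add: lext_superset[of scale "keys v \<union> keys w"] assms lookup_add scale_left_distrib sum.distrib)
  moreover have "lext scale f (smult p v) = scale p (lext scale f v)" for p v
  proof -
    have "keys (smult p v) \<subseteq> keys v"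
      by (auto simp: in_keys_iff lookup_smult)
    thus ?thesis
      by (simp add: lext_superset[of scale "keys v"] assms lookup_smult scale_sum_right)
  qed
  ultimately show ?thesis
    by (simp add: module_hom_iff assms fvec.module_axioms)
qed

lemma lext_unit_vec: "module scale \<Longrightarrow> lext scale f (unit_vec e) = f e"
  by (simp add: lext_def module.scale_one)

lemma lext_in_subspace:
  assumes "module.subspace scale S" "module scale" "\<And>e. e \<in> keys v \<Longrightarrow> f e \<in> S"
  shows "lext scale f v \<in> S"
  unfolding lext_def using assms
  by (intro module.subspace_sum module.subspace_scale[of scale]) auto

text \<open>The comparison maps and homotopies arise by choosing values on basis vectors and
  extending linearly. Their identities hold on basis vectors by choice, and this carries them over
  to the whole module.\<close>

lemma module_hom_eq_on_free_mod:
  fixes v :: "('n, 'k::field) fvec"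
  assumes "module_hom smult scale F" "module_hom smult scale G" "v \<in> free_mod b"
    and "\<And>e. (unit_vec e :: ('n, 'k) fvec) \<in> free_mod b \<Longrightarrow> F (unit_vec e) = G (unit_vec e)"
  shows "F v = G v"
proof -
  interpret F: module_hom smult scale F by fact
  interpret G: module_hom smult scale G by fact
  show ?thesis
  proof (rule additive_poly_mapping_eqI[where F = F and G = G])
    fix e and c :: "('n, 'k) mpoly" assume "e \<in> keys v"
    hence "(unit_vec e :: ('n, 'k) fvec) \<in> free_mod b"
      using assms(3) by (auto simp: free_mod_def)
    moreover have "Poly_Mapping.single e c = smult c (unit_vec e)"
      by (rule poly_mapping_eqI) (simp add: lookup_smult lookup_single when_def)
    ultimately show "F (Poly_Mapping.single e c) = G (Poly_Mapping.single e c)"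
      using assms(4) by (simp add: F.scale G.scale)
  qed (simp_all add: F.add G.add)
qed

section \<open>Coordinates modulo the irrelevant ideal\<close>

definition const_coeff :: "('n, 'k::field) fvec \<Rightarrow> int \<times> nat \<Rightarrow> 'k" where
  "const_coeff v e = lookup (lookup v e) 0"

lemma const_coeff_add: "const_coeff (v + w) e = const_coeff v e + const_coeff w e"
  by (simp add: const_coeff_def lookup_add)

lemma const_coeff_smult: "const_coeff (smult p v) e = lookup p 0 * const_coeff v e"
  by (simp add: const_coeff_def lookup_smult lookup_mult_zero)

lemma const_coeff_sum: "const_coeff (sum f A) e = (\<Sum>a\<in>A. const_coeff (f a) e)"
  by (simp add: const_coeff_def lookup_sum)

text \<open>A linear map sends \<mm> F into \<mm> F'. This is applied to a homotopy.\<close>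

lemma const_coeff_lext:
  "(\<And>e'. const_coeff v e' = 0) \<Longrightarrow> const_coeff (lext smult f v) e = 0"
  by (simp add: lext_def const_coeff_sum const_coeff_smult) (simp add: const_coeff_def)

text \<open>A nonzero constant has degree zero. This is what sorts the lifted Taylor generators by
  the degree of their least common multiple.\<close>

lemma const_coeff_free_mod_comp:
  "v \<in> free_mod_comp b c \<Longrightarrow> const_coeff v e \<noteq> 0 \<Longrightarrow> fst e = c"
  by (cases e) (force simp: const_coeff_def free_mod_comp_def homogeneous_iff)

lemma sum_pairs:
  fixes f :: "nat \<Rightarrow> nat \<Rightarrow> 'a::comm_monoid_add"
  assumes "\<And>i. f i i = 0"
  shows "(\<Sum>i<t. \<Sum>a<t. f a i) = (\<Sum>j<t. \<Sum>i<j. f i j + f j i)"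
  by (induction t) (simp_all add: assms sum.distrib ac_simps)

text \<open>Regroups by the set of three indices: the free index \<open>a\<close> is its smallest,
  middle or largest element. In the induction, \<open>sum_pairs\<close> handles the new terms in
  which the largest index \<open>t\<close> is not the free one.\<close>

lemma sum_triples:
  fixes f :: "nat \<Rightarrow> nat \<Rightarrow> nat \<Rightarrow> 'a::comm_monoid_add"
  assumes "\<And>i j. f i i j = 0" "\<And>i j. f j i j = 0"
  shows "(\<Sum>j<t. \<Sum>i<j. \<Sum>a<t. f a i j) = (\<Sum>k<t. \<Sum>j<k. \<Sum>i<j. f i j k + f j i k + f k i j)"
proof (induction t)
  case (Suc t)
  have "(\<Sum>i<t. \<Sum>a<t. f a i t) = (\<Sum>j<t. \<Sum>i<j. f i j t + f j i t)"
    by (rule sum_pairs) (rule assms)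
  with Suc show ?case
    by (simp add: assms sum.distrib ac_simps)
qed simp

section \<open>Second syzygies of a monomial ideal\<close>

lemma mon_diff_chain:
  assumes "mdvd k l" "mdvd l m"
  shows "(mon (m - l) :: ('n, 'k::field) mpoly) * mon (l - k) = mon (m - k)"
proof -
  have "m - l + (l - k) = m - k"
    using assms by (intro poly_mapping_eqI) (simp add: mdvd_def lookup_add lookup_minus)
  thus ?thesis by (simp add: mon_mult)
qed

locale minimal_resolution =
  fixes I :: "('n::finite, 'k::field) mpoly set" and \<beta> \<epsilon> \<phi>
  assumes res: "minimal_graded_free_resolution I \<beta> \<epsilon> \<phi>"
begin

lemma hom_\<epsilon>: "module_hom smult (*) \<epsilon>" and hom_\<phi>: "module_hom smult smult (\<phi> i)"
  using res by (simp_all add: minimal_graded_free_resolution_def graded_free_resolution_def)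

sublocale \<epsilon>: module_hom smult "(*)" \<epsilon>
  by (rule hom_\<epsilon>)

sublocale \<phi>: module_hom smult smult "\<phi> i" for i
  by (rule hom_\<phi>)

lemma \<epsilon>_image: "\<epsilon> ` free_mod (\<beta> 0) = I"
  and exact_0: "\<phi> 0 ` free_mod (\<beta> 1) = {v \<in> free_mod (\<beta> 0). \<epsilon> v = 0}"
  and exact_Suc: "\<phi> (Suc i) ` free_mod (\<beta> (Suc (Suc i))) = {v \<in> free_mod (\<beta> (Suc i)). \<phi> i v = 0}"
  and \<epsilon>_graded: "v \<in> free_mod_comp (\<beta> 0) c \<Longrightarrow> homogeneous c (\<epsilon> v)"
  and \<phi>_graded: "v \<in> free_mod_comp (\<beta> (Suc i)) c \<Longrightarrow> \<phi> i v \<in> free_mod_comp (\<beta> i) c"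
  using res unfolding minimal_graded_free_resolution_def graded_free_resolution_def image_subset_iff
  by simp_all

lemma const_coeff_\<phi>: "v \<in> free_mod (\<beta> (Suc i)) \<Longrightarrow> const_coeff (\<phi> i v) e = 0"
  using res unfolding minimal_graded_free_resolution_def const_coeff_def
  by (cases e) (simp add: irrelevant_ideal_lookup_zero)

lemma \<phi>_0_lift:
  assumes "v \<in> free_mod (\<beta> 0)" "\<epsilon> v = 0"
  obtains w where "w \<in> free_mod (\<beta> 1)" "\<phi> 0 w = v"
proof -
  have "v \<in> \<phi> 0 ` free_mod (\<beta> 1)"
    unfolding exact_0 using assms by simp
  thus thesis using that by auto
qed

lemma \<phi>_Suc_lift:
  assumes "v \<in> free_mod (\<beta> (Suc i))" "\<phi> i v = 0"
  obtains w where "w \<in> free_mod (\<beta> (Suc (Suc i)))" "\<phi> (Suc i) w = v"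
proof -
  have "v \<in> \<phi> (Suc i) ` free_mod (\<beta> (Suc (Suc i)))"
    unfolding exact_Suc using assms by simp
  thus thesis using that by auto
qed

text \<open>Any preimage may be replaced by its component of degree \<open>c\<close>, because the
  map is graded.\<close>

lemma \<epsilon>_homogeneous_lift:
  assumes "p \<in> I" "homogeneous c p"
  obtains v where "v \<in> free_mod_comp (\<beta> 0) c" "\<epsilon> v = p"
proof -
  obtain v where v: "v \<in> free_mod (\<beta> 0)" "\<epsilon> v = p"
    using assms(1) \<epsilon>_image by auto
  have "\<epsilon> (hcomp c v) = restr (\<lambda>m. int (mdeg m) = c) (\<epsilon> v)"
    by (rule graded_map_hcomp[OF _ _ _ v(1)])
      (simp_all add: additive_def \<epsilon>.add restr_add restr_homogeneous[OF \<epsilon>_graded])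
  also have "\<dots> = p"
    by (simp add: v restr_homogeneous[OF assms(2)])
  finally show thesis
    using that hcomp_in_free_mod_comp[OF v(1)] by blast
qed

lemma \<phi>_homogeneous_lift:
  assumes "w \<in> \<phi> i ` free_mod (\<beta> (Suc i))" "w \<in> free_mod_comp (\<beta> i) c"
  obtains v where "v \<in> free_mod_comp (\<beta> (Suc i)) c" "\<phi> i v = w"
proof -
  obtain v where v: "v \<in> free_mod (\<beta> (Suc i))" "\<phi> i v = w"
    using assms(1) by auto
  have "\<phi> i (hcomp c v) = hcomp c (\<phi> i v)"
    by (rule graded_map_hcomp[OF _ _ _ v(1)])
      (simp_all add: additive_def \<phi>.add hcomp_add hcomp_free_mod_comp[OF \<phi>_graded])
  also have "\<dots> = w"
    by (simp add: v hcomp_free_mod_comp[OF assms(2)])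
  finally show thesis
    using that hcomp_in_free_mod_comp[OF v(1)] by blast
qed

end

locale generated_resolution = minimal_resolution I \<beta> \<epsilon> \<phi>
  for I :: "('n::finite, 'k::field) mpoly set" and \<beta> \<epsilon> \<phi> +
  fixes m :: "nat \<Rightarrow> 'n monom" and t :: nat
  assumes generators_in: "i < t \<Longrightarrow> mon (m i) \<in> I"
    and generators: "p \<in> I \<Longrightarrow> \<exists>u. p = (\<Sum>i<t. u i * mon (m i))"
begin

definition lcm2 :: "nat \<Rightarrow> nat \<Rightarrow> 'n monom" where
  "lcm2 i j = mlcm (m i) (m j)"

definition lcm3 :: "nat \<Rightarrow> nat \<Rightarrow> nat \<Rightarrow> 'n monom" where
  "lcm3 i j k = mlcm (m i) (mlcm (m j) (m k))"

lemma lcm2_commute: "lcm2 j i = lcm2 i j"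
  by (simp add: lcm2_def mlcm_commute)

lemma lcm3_commute: "lcm3 j i k = lcm3 i j k" "lcm3 i k j = lcm3 i j k"
  by (simp_all add: lcm3_def mlcm_left_commute mlcm_commute)

lemma mdvd_lcm2 [simp]: "mdvd (m i) (lcm2 i j)" "mdvd (m j) (lcm2 i j)"
  by (simp_all add: lcm2_def)

lemma mdvd_lcm3 [simp]: "mdvd (lcm2 i j) (lcm3 i j k)" "mdvd (lcm2 i k) (lcm3 i j k)"
  "mdvd (lcm2 j k) (lcm3 i j k)"
  by (simp_all add: lcm2_def lcm3_def mdvd_def lookup_mlcm max.coboundedI2)

text \<open>\<open>G\<close>, and below \<open>P\<close> and \<open>W\<close>, are the images of the
  Taylor generators of homological degree 0, 1 and 2 under a comparison map into the resolution.
  Each is chosen homogeneous of the degree of its least common multiple, so that degrees can be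
  compared in the end.\<close>

lemma lifts_0:
  obtains G where "\<And>i. i < t \<Longrightarrow> G i \<in> free_mod_comp (\<beta> 0) (int (mdeg (m i)))"
    "\<And>i. i < t \<Longrightarrow> \<epsilon> (G i) = mon (m i)"
proof -
  have "\<exists>v. v \<in> free_mod_comp (\<beta> 0) (int (mdeg (m i))) \<and> \<epsilon> v = mon (m i)" if "i < t" for i
    using \<epsilon>_homogeneous_lift[OF generators_in[OF that], of "int (mdeg (m i))"]
    by (auto simp: homogeneous_def mon_def)
  thus thesis using that by metis
qed

lemma lifts_1:
  assumes G: "\<And>i. i < t \<Longrightarrow> G i \<in> free_mod_comp (\<beta> 0) (int (mdeg (m i)))"
    "\<And>i. i < t \<Longrightarrow> \<epsilon> (G i) = mon (m i)"
  obtains P where "\<And>i j. i < t \<Longrightarrow> j < t \<Longrightarrow> P i j \<in> free_mod_comp (\<beta> 1) (int (mdeg (lcm2 i j)))"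
    "\<And>i j. i < t \<Longrightarrow> j < t \<Longrightarrow> \<phi> 0 (P i j) =
      smult (mon (lcm2 i j - m j)) (G j) - smult (mon (lcm2 i j - m i)) (G i)"
proof -
  have "\<exists>v. v \<in> free_mod_comp (\<beta> 1) (int (mdeg (lcm2 i j))) \<and>
      \<phi> 0 v = smult (mon (lcm2 i j - m j)) (G j) - smult (mon (lcm2 i j - m i)) (G i)"
    (is "\<exists>v. _ \<and> _ = ?w") if ij: "i < t" "j < t" for i j
  proof -
    have w: "?w \<in> free_mod_comp (\<beta> 0) (int (mdeg (lcm2 i j)))"
      by (intro free_mod_comp_diff free_mod_comp_mon_smult G ij) simp_all
    moreover have "\<epsilon> ?w = 0"
      by (simp add: \<epsilon>.diff \<epsilon>.scale G ij mon_diff_mult)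
    ultimately have "?w \<in> \<phi> 0 ` free_mod (\<beta> (Suc 0))"
      using exact_0 free_mod_comp_subset[OF w] by auto
    from \<phi>_homogeneous_lift[OF this w] show ?thesis by auto
  qed
  thus thesis using that by metis
qed

lemma lifts_2:
  assumes P: "\<And>i j. i < t \<Longrightarrow> j < t \<Longrightarrow> P i j \<in> free_mod_comp (\<beta> 1) (int (mdeg (lcm2 i j)))"
    "\<And>i j. i < t \<Longrightarrow> j < t \<Longrightarrow> \<phi> 0 (P i j) =
      smult (mon (lcm2 i j - m j)) (G j) - smult (mon (lcm2 i j - m i)) (G i)"
  obtains W where "\<And>i j k. i < t \<Longrightarrow> j < t \<Longrightarrow> k < t \<Longrightarrow>
      W i j k \<in> free_mod_comp (\<beta> 2) (int (mdeg (lcm3 i j k)))"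
    "\<And>i j k. i < t \<Longrightarrow> j < t \<Longrightarrow> k < t \<Longrightarrow> \<phi> 1 (W i j k) =
      smult (mon (lcm3 i j k - lcm2 j k)) (P j k) - smult (mon (lcm3 i j k - lcm2 i k)) (P i k)
      + smult (mon (lcm3 i j k - lcm2 i j)) (P i j)"
proof -
  have "\<exists>v. v \<in> free_mod_comp (\<beta> 2) (int (mdeg (lcm3 i j k))) \<and> \<phi> 1 v =
      smult (mon (lcm3 i j k - lcm2 j k)) (P j k) - smult (mon (lcm3 i j k - lcm2 i k)) (P i k)
      + smult (mon (lcm3 i j k - lcm2 i j)) (P i j)"
    (is "\<exists>v. _ \<and> _ = ?w") if ijk: "i < t" "j < t" "k < t" for i j k
  proof -
    have w: "?w \<in> free_mod_comp (\<beta> 1) (int (mdeg (lcm3 i j k)))"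
      by (intro free_mod_comp_diff free_mod_comp_add free_mod_comp_mon_smult P ijk) simp_all
    \<comment> \<open>Once the monomial factors are merged, each of \<open>G i\<close>,
      \<open>G j\<close>, \<open>G k\<close> occurs twice, with opposite signs.\<close>
    moreover have "\<phi> 0 ?w = 0"
      by (simp add: \<phi>.diff \<phi>.add \<phi>.scale P ijk fvec.scale_right_diff_distrib mon_diff_chain)
    ultimately have "?w \<in> \<phi> 1 ` free_mod (\<beta> (Suc 1))"
      using exact_Suc[of 0] free_mod_comp_subset[OF w] by auto
    from \<phi>_homogeneous_lift[OF this w] show ?thesis by (auto simp: numeral_2_eq_2)
  qed
  note * = someI_ex[OF this]
  show thesis
    by (rule that; (rule *[THEN conjunct1] | rule *[THEN conjunct2]); assumption)
qed

text \<open>This is \<open>taylor_exact_0\<close> in coordinates: a chain in the ideal of a least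
  common multiple is divided by that monomial to recover its coefficient, and the inclusions of
  ideals turn into multiplications by monomials.\<close>

lemma taylor_boundary_0:
  assumes u: "(\<Sum>i<t. u i * mon (m i)) = (0 :: ('n, 'k) mpoly)"
  obtains q where "\<And>i j. q j i = - q i j" "\<And>i. q i i = 0"
    "\<And>i. i < t \<Longrightarrow> u i = (\<Sum>a<t. q a i * mon (lcm2 a i - m i))"
proof (rule taylor_exact_0[where U = "\<lambda>i. u i * mon (m i)", OF keys_mult_mon u])
  fix Q :: "nat \<Rightarrow> nat \<Rightarrow> ('n, 'k) mpoly"
  assume Q: "\<And>i j. Q j i = - Q i j" "\<And>i. Q i i = 0"
    "\<And>i j. i < t \<Longrightarrow> j < t \<Longrightarrow> keys (Q i j) \<subseteq> {\<mu>. mdvd (m i) \<mu> \<and> mdvd (m j) \<mu>}"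
    "\<And>i. i < t \<Longrightarrow> (\<Sum>a<t. Q a i) = u i * mon (m i)"
  show thesis
  proof (rule that[of "\<lambda>i j. mdiv (Q i j) (lcm2 i j)"])
    fix i j
    show "mdiv (Q j i) (lcm2 j i) = - mdiv (Q i j) (lcm2 i j)"
      by (simp add: Q(1)[of i j] lcm2_commute mdiv_uminus)
  next
    fix i assume i: "i < t"
    have "u i = mdiv (\<Sum>a<t. Q a i) (m i)"
      by (simp add: Q(4)[OF i])
    also have "\<dots> = (\<Sum>a<t. mdiv (mdiv (Q a i) (lcm2 a i) * mon (lcm2 a i)) (m i))"
      using Q(3)[OF _ i] by (simp add: mdiv_sum mdiv_mult_mon_cancel lcm2_def mlcm_mdvd_iff)
    finally show "u i = (\<Sum>a<t. mdiv (Q a i) (lcm2 a i) * mon (lcm2 a i - m i))"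
      by (simp add: mdiv_mult_mon_add)
  qed (simp add: Q(2))
qed

lemma taylor_boundary_1:
  fixes q :: "nat \<Rightarrow> nat \<Rightarrow> ('n, 'k) mpoly"
  assumes q: "\<And>i j. q j i = - q i j" "\<And>i. q i i = 0"
    and cycle: "\<And>i. i < t \<Longrightarrow> (\<Sum>a<t. q a i * mon (lcm2 a i - m i)) = 0"
  obtains s where "\<And>a i j. s i a j = - s a i j" "\<And>a i j. s a j i = - s a i j"
    "\<And>i j. s i i j = 0" "\<And>i j. s i j j = 0"
    "\<And>i j. i < t \<Longrightarrow> j < t \<Longrightarrow> q i j = (\<Sum>a<t. s a i j * mon (lcm3 a i j - lcm2 i j))"
proof -
  let ?p = "\<lambda>i j. q i j * mon (lcm2 i j)"
  have p1: "?p j i = - ?p i j" for i j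
    using q(1)[of j i] by (simp add: lcm2_commute)
  have p0: "?p i i = 0" for i
    by (simp add: q(2))
  have p2: "keys (?p i j) \<subseteq> {\<mu>. mdvd (m i) \<mu> \<and> mdvd (m j) \<mu>}" for i j
    using keys_mult_mon[of "q i j" "lcm2 i j"] by (auto simp: lcm2_def mlcm_mdvd_iff)
  have p3: "(\<Sum>a<t. ?p a i) = 0" if "i < t" for i
  proof -
    have "(\<Sum>a<t. ?p a i) = (\<Sum>a<t. q a i * mon (lcm2 a i - m i)) * mon (m i)"
      by (simp add: sum_distrib_right mult.assoc mon_diff_mult)
    thus ?thesis by (simp add: cycle that)
  qed
  show thesis
  proof (rule taylor_exact_1[where p = ?p and t = t and m = m, OF p1 p0 p2 p3])
    fix A :: "nat \<Rightarrow> nat \<Rightarrow> nat \<Rightarrow> ('n, 'k) mpoly"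
    assume A: "\<And>a i j. A i a j = - A a i j" "\<And>a i j. A a j i = - A a i j"
      "\<And>i j. A i i j = 0" "\<And>i j. A i j j = 0"
      "\<And>a i j. a < t \<Longrightarrow> i < t \<Longrightarrow> j < t \<Longrightarrow>
        keys (A a i j) \<subseteq> {\<mu>. mdvd (m a) \<mu> \<and> mdvd (m i) \<mu> \<and> mdvd (m j) \<mu>}"
      "\<And>i j. i < t \<Longrightarrow> j < t \<Longrightarrow> (\<Sum>a<t. A a i j) = ?p i j"
    show thesis
    proof (rule that[of "\<lambda>a i j. mdiv (A a i j) (lcm3 a i j)"])
      fix a i j
      show "mdiv (A i a j) (lcm3 i a j) = - mdiv (A a i j) (lcm3 a i j)"
        by (simp add: A(1)[of i a j] lcm3_commute mdiv_uminus)
      show "mdiv (A a j i) (lcm3 a j i) = - mdiv (A a i j) (lcm3 a i j)"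
        by (simp add: A(2)[of a j i] lcm3_commute mdiv_uminus)
    next
      fix i j assume ij: "i < t" "j < t"
      have "q i j = mdiv (\<Sum>a<t. A a i j) (lcm2 i j)"
        by (simp add: A(6)[OF ij])
      also have "\<dots> = (\<Sum>a<t. mdiv (mdiv (A a i j) (lcm3 a i j) * mon (lcm3 a i j)) (lcm2 i j))"
        using A(5)[OF _ ij] by (simp add: mdiv_sum mdiv_mult_mon_cancel lcm3_def mlcm_mdvd_iff)
      finally show "q i j = (\<Sum>a<t. mdiv (A a i j) (lcm3 a i j) * mon (lcm3 a i j - lcm2 i j))"
        by (simp add: mdiv_mult_mon_add)
    qed (simp_all add: A(3,4))
  qed
qed

end

lemma choice_pair:
  assumes "\<forall>e. P e \<longrightarrow> (\<exists>c x. Q e c x)"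
  shows "\<exists>c x. \<forall>e. P e \<longrightarrow> Q e (c e) (x e)"
  using assms by metis

context generated_resolution
begin

abbreviation uvec :: "int \<times> nat \<Rightarrow> ('n, 'k) fvec" where
  "uvec \<equiv> unit_vec"

text \<open>The comparison map to the Taylor complex sends \<open>v\<close> to the family \<open>u i v\<close>, and the lifts
  \<open>G i\<close> lead back to \<open>F\<^sub>0\<close>; \<open>h\<close> is a homotopy from the composite to the identity.\<close>

lemma homotopy_0:
  assumes G: "\<And>i. i < t \<Longrightarrow> G i \<in> free_mod_comp (\<beta> 0) (int (mdeg (m i)))"
    "\<And>i. i < t \<Longrightarrow> \<epsilon> (G i) = mon (m i)"
  obtains u h where "\<And>i. module_hom smult (*) (u i)" "module_hom smult smult h"
    "\<And>v. v \<in> free_mod (\<beta> 0) \<Longrightarrow> (\<Sum>i<t. u i v * mon (m i)) = \<epsilon> v"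
    "\<And>v. v \<in> free_mod (\<beta> 0) \<Longrightarrow> h v \<in> free_mod (\<beta> 1)"
    "\<And>v. v \<in> free_mod (\<beta> 0) \<Longrightarrow> \<phi> 0 (h v) = v - (\<Sum>i<t. smult (u i v) (G i))"
proof -
  have "\<forall>e. uvec e \<in> free_mod (\<beta> 0) \<longrightarrow>
      (\<exists>c x. (\<Sum>i<t. c i * mon (m i)) = \<epsilon> (uvec e) \<and> x \<in> free_mod (\<beta> 1) \<and>
      \<phi> 0 x = uvec e - (\<Sum>i<t. smult (c i) (G i)))" (is "\<forall>e. _ \<longrightarrow> ?Q e")
  proof (intro allI impI)
    fix e assume e: "uvec e \<in> free_mod (\<beta> 0)"
    have "\<epsilon> (uvec e) \<in> I"
      using \<epsilon>_image e by auto
    then obtain c where c: "\<epsilon> (uvec e) = (\<Sum>i<t. c i * mon (m i))"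
      using generators by blast
    let ?w = "uvec e - (\<Sum>i<t. smult (c i) (G i))"
    have "?w \<in> free_mod (\<beta> 0)"
      by (intro fvec.subspace_diff[OF subspace_free_mod] fvec.subspace_sum[OF subspace_free_mod]
          fvec.subspace_scale[OF subspace_free_mod] e free_mod_comp_subset[OF G(1)]) simp
    moreover have "\<epsilon> ?w = 0"
      by (simp add: \<epsilon>.diff \<epsilon>.sum \<epsilon>.scale G c)
    ultimately show "?Q e"
      by (rule \<phi>_0_lift) (use c in auto)
  qed
  from choice_pair[OF this] obtain c x where *: "\<forall>e. uvec e \<in> free_mod (\<beta> 0) \<longrightarrow>
      (\<Sum>i<t. c e i * mon (m i)) = \<epsilon> (uvec e) \<and> x e \<in> free_mod (\<beta> 1) \<and>
      \<phi> 0 (x e) = uvec e - (\<Sum>i<t. smult (c e i) (G i))"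
    by (elim exE)
  note cx = *[rule_format, THEN conjunct1] *[rule_format, THEN conjunct2, THEN conjunct1]
    *[rule_format, THEN conjunct2, THEN conjunct2]
  define u where "u i = lext (*) (\<lambda>e. c e i)" for i
  define h where "h = lext smult x"
  have u: "module_hom smult (*) (u i)" for i
    unfolding u_def by (intro module_hom_lext mpoly.module_axioms)
  have h: "module_hom smult smult h"
    unfolding h_def by (intro module_hom_lext fvec.module_axioms)
  have u_unit: "u i (uvec e) = c e i" for i e
    by (simp add: u_def lext_unit_vec[OF mpoly.module_axioms])
  have h_unit: "h (uvec e) = x e" for e
    by (simp add: h_def lext_unit_vec[OF fvec.module_axioms])
  show thesis
  proof (rule that[of u h])
    fix v :: "('n, 'k) fvec" assume v: "v \<in> free_mod (\<beta> 0)"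
    show "(\<Sum>i<t. u i v * mon (m i)) = \<epsilon> v"
    proof (rule module_hom_eq_on_free_mod[OF _ hom_\<epsilon> v])
      show "module_hom smult (*) (\<lambda>v. \<Sum>i<t. u i v * mon (m i))"
        by (intro fvec_mpoly.module_hom_sum fvec_mpoly.module_hom_compose_scale u)
          (simp add: mpoly.module_axioms fvec.module_axioms)
    qed (simp add: u_unit cx)
    show "h v \<in> free_mod (\<beta> 1)"
      unfolding h_def using v
      by (intro lext_in_subspace subspace_free_mod fvec.module_axioms cx) (auto simp: free_mod_def)
    show "\<phi> 0 (h v) = v - (\<Sum>i<t. smult (u i v) (G i))"
    proof (rule module_hom_eq_on_free_mod[OF _ _ v])
      show "module_hom smult smult (\<lambda>v. \<phi> 0 (h v))"
        using module_hom_compose[OF h hom_\<phi>] by (simp add: o_def)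
      show "module_hom smult smult (\<lambda>v. v - (\<Sum>i<t. smult (u i v) (G i)))"
        by (intro fvec_fvec.module_hom_sub fvec.module_hom_ident fvec_fvec.module_hom_sum
            fvec_fvec.module_hom_compose_scale u) (simp add: fvec.module_axioms)
    qed (simp add: u_unit h_unit cx)
  qed (rule u h)+
qed

text \<open>For \<open>v\<close> in F_1 the family \<open>u i (\<phi> 0 v)\<close> is a Taylor
  cycle, so it bounds a family \<open>q\<close>, which is the comparison map on F_1. Subtracting
  \<open>h (\<phi> 0 v)\<close> and the image of \<open>q\<close> from \<open>v\<close> leaves a
  cycle of \<open>\<phi> 0\<close>; lifting it gives the next homotopy, with values \<open>x\<close>
  on the basis.\<close>

lemma homotopy_1:
  assumes u: "\<And>i. module_hom smult (*) (u i)" and h: "module_hom smult smult h"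
    and u_eq: "\<And>v. v \<in> free_mod (\<beta> 0) \<Longrightarrow> (\<Sum>i<t. u i v * mon (m i)) = \<epsilon> v"
    and h_in: "\<And>v. v \<in> free_mod (\<beta> 0) \<Longrightarrow> h v \<in> free_mod (\<beta> 1)"
    and h_eq: "\<And>v. v \<in> free_mod (\<beta> 0) \<Longrightarrow> \<phi> 0 (h v) = v - (\<Sum>i<t. smult (u i v) (G i))"
    and P: "\<And>i j. i < t \<Longrightarrow> j < t \<Longrightarrow> P i j \<in> free_mod_comp (\<beta> 1) (int (mdeg (lcm2 i j)))"
    "\<And>i j. i < t \<Longrightarrow> j < t \<Longrightarrow> \<phi> 0 (P i j) =
      smult (mon (lcm2 i j - m j)) (G j) - smult (mon (lcm2 i j - m i)) (G i)"
  obtains q x where "\<And>v i j. v \<in> free_mod (\<beta> 1) \<Longrightarrow> q j i v = - q i j v"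
    "\<And>v i. v \<in> free_mod (\<beta> 1) \<Longrightarrow> q i i v = 0"
    "\<And>v i. v \<in> free_mod (\<beta> 1) \<Longrightarrow> i < t \<Longrightarrow> u i (\<phi> 0 v) = (\<Sum>a<t. q a i v * mon (lcm2 a i - m i))"
    "\<And>v. v \<in> free_mod (\<beta> 1) \<Longrightarrow> lext smult x v \<in> free_mod (\<beta> 2)"
    "\<And>v. v \<in> free_mod (\<beta> 1) \<Longrightarrow>
      \<phi> 1 (lext smult x v) = v - h (\<phi> 0 v) - (\<Sum>j<t. \<Sum>i<j. smult (q i j v) (P i j))"
proof -
  interpret u: module_hom smult "(*)" "u i" for i by (rule u)
  have "\<forall>e. uvec e \<in> free_mod (\<beta> 1) \<longrightarrow>
      (\<exists>c x. (\<forall>i j. c j i = - c i j) \<and> (\<forall>i. c i i = 0) \<and>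
      (\<forall>i<t. u i (\<phi> 0 (uvec e)) = (\<Sum>a<t. c a i * mon (lcm2 a i - m i))) \<and>
      x \<in> free_mod (\<beta> 2) \<and>
      \<phi> 1 x = uvec e - h (\<phi> 0 (uvec e)) - (\<Sum>j<t. \<Sum>i<j. smult (c i j) (P i j)))" (is "\<forall>e. _ \<longrightarrow> ?Q e")
  proof (intro allI impI)
    fix e assume e: "uvec e \<in> free_mod (\<beta> 1)"
    have \<phi>e: "\<phi> 0 (uvec e) \<in> free_mod (\<beta> 0)" and \<epsilon>\<phi>: "\<epsilon> (\<phi> 0 (uvec e)) = 0"
      using exact_0 e by auto
    have "(\<Sum>i<t. u i (\<phi> 0 (uvec e)) * mon (m i)) = 0"
      using u_eq[OF \<phi>e] \<epsilon>\<phi> by simp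
    thus "?Q e"
    proof (rule taylor_boundary_0)
      fix c :: "nat \<Rightarrow> nat \<Rightarrow> ('n, 'k) mpoly"
      assume c: "\<And>i j. c j i = - c i j" "\<And>i. c i i = 0"
        "\<And>i. i < t \<Longrightarrow> u i (\<phi> 0 (uvec e)) = (\<Sum>a<t. c a i * mon (lcm2 a i - m i))"
      let ?f = "\<lambda>a i. smult (c a i) (smult (mon (lcm2 a i - m i)) (G i))"
      \<comment> \<open>Expressing \<open>u\<close> through \<open>c\<close> gives a sum over
        ordered pairs. By alternation the two orders of a pair combine to a multiple of
        \<open>\<phi> 0 (P i j)\<close>.\<close>
      have "(\<Sum>i<t. smult (u i (\<phi> 0 (uvec e))) (G i)) = (\<Sum>i<t. \<Sum>a<t. ?f a i)"
        by (simp add: c(3) fvec.scale_sum_left)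
      also have "\<dots> = (\<Sum>j<t. \<Sum>i<j. ?f i j + ?f j i)"
        by (rule sum_pairs) (simp add: c(2))
      also have "\<dots> = (\<Sum>j<t. \<Sum>i<j. smult (c i j) (\<phi> 0 (P i j)))"
      proof (intro sum.cong refl)
        fix j i assume "j \<in> {..<t}" "i \<in> {..<j}"
        thus "?f i j + ?f j i = smult (c i j) (\<phi> 0 (P i j))"
          by (simp add: P(2) c(1)[of j i] lcm2_commute[of j i] fvec.scale_right_diff_distrib
              del: fvec.scale_scale)
      qed
      finally have sum_eq: "(\<Sum>i<t. smult (u i (\<phi> 0 (uvec e))) (G i))
        = \<phi> 0 (\<Sum>j<t. \<Sum>i<j. smult (c i j) (P i j))"
        by (simp add: \<phi>.sum \<phi>.scale)
      let ?w = "uvec e - h (\<phi> 0 (uvec e)) - (\<Sum>j<t. \<Sum>i<j. smult (c i j) (P i j))"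
      have "?w \<in> free_mod (\<beta> 1)"
        by (intro fvec.subspace_diff[OF subspace_free_mod] fvec.subspace_sum[OF subspace_free_mod]
            fvec.subspace_scale[OF subspace_free_mod] e h_in \<phi>e free_mod_comp_subset[OF P(1)]) auto
      moreover have "\<phi> 0 ?w = 0"
        by (simp only: \<phi>.diff h_eq[OF \<phi>e] sum_eq) simp
      ultimately obtain x where "x \<in> free_mod (\<beta> 2)" "\<phi> 1 x = ?w"
        using \<phi>_Suc_lift[of ?w 0] by (auto simp: numeral_2_eq_2)
      with c show ?thesis by blast
    qed
  qed
  from choice_pair[OF this] obtain c x where *: "\<forall>e. uvec e \<in> free_mod (\<beta> 1) \<longrightarrow>
      (\<forall>i j. c e j i = - c e i j) \<and> (\<forall>i. c e i i = 0) \<and>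
      (\<forall>i<t. u i (\<phi> 0 (uvec e)) = (\<Sum>a<t. c e a i * mon (lcm2 a i - m i))) \<and>
      x e \<in> free_mod (\<beta> 2) \<and>
      \<phi> 1 (x e) = uvec e - h (\<phi> 0 (uvec e)) - (\<Sum>j<t. \<Sum>i<j. smult (c e i j) (P i j))"
    by (elim exE)
  note c = *[rule_format, THEN conjunct1, rule_format]
    *[rule_format, THEN conjunct2, THEN conjunct1, rule_format]
    *[rule_format, THEN conjunct2, THEN conjunct2, THEN conjunct1, rule_format]
  note x = *[rule_format, THEN conjunct2, THEN conjunct2, THEN conjunct2, THEN conjunct1]
    *[rule_format, THEN conjunct2, THEN conjunct2, THEN conjunct2, THEN conjunct2]
  define q where "q i j = lext (*) (\<lambda>e. c e i j)" for i j
  have q: "module_hom smult (*) (q i j)" for i j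
    unfolding q_def by (intro module_hom_lext mpoly.module_axioms)
  have q_unit: "q i j (uvec e) = c e i j" for i j e
    by (simp add: q_def lext_unit_vec[OF mpoly.module_axioms])
  have x_unit: "lext smult x (uvec e) = x e" for e
    by (simp add: lext_unit_vec[OF fvec.module_axioms])
  have h\<phi>: "module_hom smult smult (\<lambda>v. h (\<phi> 0 v))"
    using module_hom_compose[OF hom_\<phi> h] by (simp add: o_def)
  show thesis
  proof (rule that[of q x])
    fix v :: "('n, 'k) fvec" and i j assume v: "v \<in> free_mod (\<beta> 1)"
    show "q j i v = - q i j v"
      by (rule module_hom_eq_on_free_mod[OF q fvec_mpoly.module_hom_neg[OF q] v]) (simp only: q_unit, rule c)
    show "q i i v = 0"
      by (rule module_hom_eq_on_free_mod[OF q _ v, where G = "\<lambda>_. 0"])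
        (simp_all add: q_unit c(2) module_hom_iff fvec.module_axioms mpoly.module_axioms)
    show "lext smult x v \<in> free_mod (\<beta> 2)"
      using v by (intro lext_in_subspace subspace_free_mod fvec.module_axioms x)
        (auto simp: free_mod_def)
    show "\<phi> 1 (lext smult x v) = v - h (\<phi> 0 v) - (\<Sum>j<t. \<Sum>i<j. smult (q i j v) (P i j))"
    proof (rule module_hom_eq_on_free_mod[OF _ _ v])
      show "module_hom smult smult (\<lambda>v. \<phi> 1 (lext smult x v))"
        using module_hom_compose[OF module_hom_lext[OF fvec.module_axioms] hom_\<phi>]
        by (simp add: o_def)
      show "module_hom smult smult (\<lambda>v. v - h (\<phi> 0 v) - (\<Sum>j<t. \<Sum>i<j. smult (q i j v) (P i j)))"
        by (intro fvec_fvec.module_hom_sub fvec.module_hom_ident fvec_fvec.module_hom_sum h\<phi>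
            fvec_fvec.module_hom_compose_scale q) (simp_all add: fvec.module_axioms)
    qed (simp only: q_unit x_unit, rule x)
  next
    fix v :: "('n, 'k) fvec" and i assume v: "v \<in> free_mod (\<beta> 1)" and i: "i < t"
    show "u i (\<phi> 0 v) = (\<Sum>a<t. q a i v * mon (lcm2 a i - m i))"
    proof (rule module_hom_eq_on_free_mod[OF _ _ v])
      show "module_hom smult (*) (\<lambda>v. u i (\<phi> 0 v))"
        using module_hom_compose[OF hom_\<phi> u] by (simp add: o_def)
      show "module_hom smult (*) (\<lambda>v. \<Sum>a<t. q a i v * mon (lcm2 a i - m i))"
        by (intro fvec_mpoly.module_hom_sum fvec_mpoly.module_hom_compose_scale q)
          (simp add: mpoly.module_axioms fvec.module_axioms)
    qed (simp only: q_unit, rule c(3)[OF _ i])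
  qed
qed

text \<open>As \<open>const_coeff\<close> is reduction modulo \<open>\<mm>\<close>, this says that the classes of the lifts \<open>W i j k\<close>
  of the Taylor generators span \<open>F\<^sub>2 / \<mm> F\<^sub>2\<close>.\<close>

lemma second_syzygies_generated:
  obtains W :: "nat \<Rightarrow> nat \<Rightarrow> nat \<Rightarrow> ('n, 'k) fvec"
    where "\<And>i j k. i < t \<Longrightarrow> j < t \<Longrightarrow> k < t \<Longrightarrow>
      W i j k \<in> free_mod_comp (\<beta> 2) (int (mdeg (lcm3 i j k)))"
    "\<And>y :: ('n, 'k) fvec. y \<in> free_mod (\<beta> 2) \<Longrightarrow> \<exists>s :: nat \<Rightarrow> nat \<Rightarrow> nat \<Rightarrow> 'k.
      \<forall>e. const_coeff y e = (\<Sum>k<t. \<Sum>j<k. \<Sum>i<j. s i j k * const_coeff (W i j k) e)"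
proof -
  obtain G where G: "\<And>i. i < t \<Longrightarrow> G i \<in> free_mod_comp (\<beta> 0) (int (mdeg (m i)))"
    "\<And>i. i < t \<Longrightarrow> \<epsilon> (G i) = mon (m i)"
    using lifts_0 by metis
  obtain P where P: "\<And>i j. i < t \<Longrightarrow> j < t \<Longrightarrow> P i j \<in> free_mod_comp (\<beta> 1) (int (mdeg (lcm2 i j)))"
    "\<And>i j. i < t \<Longrightarrow> j < t \<Longrightarrow> \<phi> 0 (P i j) =
      smult (mon (lcm2 i j - m j)) (G j) - smult (mon (lcm2 i j - m i)) (G i)"
    using lifts_1[OF G] by metis
  obtain W where W: "\<And>i j k. i < t \<Longrightarrow> j < t \<Longrightarrow> k < t \<Longrightarrow>
      W i j k \<in> free_mod_comp (\<beta> 2) (int (mdeg (lcm3 i j k)))"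
    "\<And>i j k. i < t \<Longrightarrow> j < t \<Longrightarrow> k < t \<Longrightarrow> \<phi> 1 (W i j k) =
      smult (mon (lcm3 i j k - lcm2 j k)) (P j k) - smult (mon (lcm3 i j k - lcm2 i k)) (P i k)
      + smult (mon (lcm3 i j k - lcm2 i j)) (P i j)"
    using lifts_2[OF P] by metis
  show thesis
  proof (rule homotopy_0[OF G])
    fix u :: "nat \<Rightarrow> ('n, 'k) fvec \<Rightarrow> ('n, 'k) mpoly" and h
    assume uh: "\<And>i. module_hom smult (*) (u i)" "module_hom smult smult h"
      "\<And>v. v \<in> free_mod (\<beta> 0) \<Longrightarrow> (\<Sum>i<t. u i v * mon (m i)) = \<epsilon> v"
      "\<And>v. v \<in> free_mod (\<beta> 0) \<Longrightarrow> h v \<in> free_mod (\<beta> 1)"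
      "\<And>v. v \<in> free_mod (\<beta> 0) \<Longrightarrow> \<phi> 0 (h v) = v - (\<Sum>i<t. smult (u i v) (G i))"
    interpret h: module_hom smult smult h by (rule uh)
    show thesis
    proof (rule homotopy_1[OF uh P])
      fix q :: "nat \<Rightarrow> nat \<Rightarrow> ('n, 'k) fvec \<Rightarrow> ('n, 'k) mpoly" and x
      assume q: "\<And>v i j. v \<in> free_mod (\<beta> 1) \<Longrightarrow> q j i v = - q i j v"
        "\<And>v i. v \<in> free_mod (\<beta> 1) \<Longrightarrow> q i i v = 0"
        "\<And>v i. v \<in> free_mod (\<beta> 1) \<Longrightarrow> i < t \<Longrightarrow> u i (\<phi> 0 v) = (\<Sum>a<t. q a i v * mon (lcm2 a i - m i))"
        and x: "\<And>v. v \<in> free_mod (\<beta> 1) \<Longrightarrow> lext smult x v \<in> free_mod (\<beta> 2)"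
        "\<And>v. v \<in> free_mod (\<beta> 1) \<Longrightarrow>
          \<phi> 1 (lext smult x v) = v - h (\<phi> 0 v) - (\<Sum>j<t. \<Sum>i<j. smult (q i j v) (P i j))"
      show thesis
      proof (rule that[of W])
        fix y :: "('n, 'k) fvec" assume y: "y \<in> free_mod (\<beta> 2)"
        let ?v = "\<phi> 1 y"
        have v: "?v \<in> free_mod (\<beta> 1)" "\<phi> 0 ?v = 0"
          using exact_Suc[of 0] y by (auto simp: numeral_2_eq_2)
        \<comment> \<open>As \<open>?v\<close> is a cycle, its image \<open>q\<close> in the Taylor
          complex is one too. A chain \<open>s\<close> bounding \<open>q\<close> supplies the
          coefficients of \<open>y\<close>.\<close>
        have "(\<Sum>a<t. q a i ?v * mon (lcm2 a i - m i)) = 0" if "i < t" for i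
        proof -
          interpret u: module_hom smult "(*)" "u i" by (rule uh)
          show ?thesis using q(3)[OF v(1) that] unfolding v(2) u.zero by (rule sym)
        qed
        thus "\<exists>s :: nat \<Rightarrow> nat \<Rightarrow> nat \<Rightarrow> 'k.
            \<forall>e. const_coeff y e = (\<Sum>k<t. \<Sum>j<k. \<Sum>i<j. s i j k * const_coeff (W i j k) e)"
        proof (rule taylor_boundary_1[where q = "\<lambda>i j. q i j ?v", OF q(1)[OF v(1)] q(2)[OF v(1)]])
          fix s :: "nat \<Rightarrow> nat \<Rightarrow> nat \<Rightarrow> ('n, 'k) mpoly"
          assume s: "\<And>a i j. s i a j = - s a i j" "\<And>a i j. s a j i = - s a i j"
            "\<And>i j. s i i j = 0" "\<And>i j. s i j j = 0"
            "\<And>i j. i < t \<Longrightarrow> j < t \<Longrightarrow> q i j ?v = (\<Sum>a<t. s a i j * mon (lcm3 a i j - lcm2 i j))"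
          let ?f = "\<lambda>a i j. smult (s a i j) (smult (mon (lcm3 a i j - lcm2 i j)) (P i j))"
          let ?S = "\<Sum>k<t. \<Sum>j<k. \<Sum>i<j. smult (s i j k) (W i j k)"
          have s0: "s j i j = 0" for i j
            using s(1)[of j i j] s(4)[of i j] by simp
          have "(\<Sum>j<t. \<Sum>i<j. smult (q i j ?v) (P i j)) = (\<Sum>j<t. \<Sum>i<j. \<Sum>a<t. ?f a i j)"
            by (intro sum.cong refl) (simp add: s(5) fvec.scale_sum_left del: One_nat_def)
          also have "\<dots> = (\<Sum>k<t. \<Sum>j<k. \<Sum>i<j. ?f i j k + ?f j i k + ?f k i j)"
            by (rule sum_triples) (simp_all add: s(3) s0)
          also have "\<dots> = (\<Sum>k<t. \<Sum>j<k. \<Sum>i<j. smult (s i j k) (\<phi> 1 (W i j k)))"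
          proof (intro sum.cong refl)
            fix k j i assume *: "k \<in> {..<t}" "j \<in> {..<k}" "i \<in> {..<j}"
            \<comment> \<open>Moving \<open>k\<close> to the front is an even permutation, swapping
              \<open>i\<close> and \<open>j\<close> an odd one. These are the signs in
              \<open>\<phi> 1 (W i j k)\<close>.\<close>
            have "s k i j = s i j k" "s j i k = - s i j k"
              using s(1)[of k i j] s(2)[of i k j] s(1)[of j i k] by simp_all
            moreover have "lcm3 k i j = lcm3 i j k" "lcm3 j i k = lcm3 i j k"
              by (metis lcm3_commute)+
            ultimately show "?f i j k + ?f j i k + ?f k i j = smult (s i j k) (\<phi> 1 (W i j k))"
              using * by (simp add: W(2) fvec.scale_right_diff_distrib fvec.scale_right_distrib
                  del: fvec.scale_scale One_nat_def)
          qed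
          finally have "\<phi> 1 (lext smult x ?v) = ?v - \<phi> 1 ?S"
            by (simp add: x(2)[OF v(1)] v(2) h.zero \<phi>.sum \<phi>.scale del: One_nat_def)
          hence "\<phi> 1 (y - ?S - lext smult x ?v) = 0"
            by (simp add: \<phi>.diff)
          moreover have "y - ?S - lext smult x ?v \<in> free_mod (\<beta> 2)"
            by (intro fvec.subspace_diff[OF subspace_free_mod] fvec.subspace_sum[OF subspace_free_mod]
                fvec.subspace_scale[OF subspace_free_mod] y x v free_mod_comp_subset[OF W(1)]) auto
          ultimately obtain z where z: "z \<in> free_mod (\<beta> (Suc 2))" "\<phi> 2 z = y - ?S - lext smult x ?v"
            using \<phi>_Suc_lift[of "y - ?S - lext smult x ?v" 1] by (auto simp: numeral_2_eq_2)
          have "const_coeff y e = (\<Sum>k<t. \<Sum>j<k. \<Sum>i<j. lookup (s i j k) 0 * const_coeff (W i j k) e)" for e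
          proof -
            \<comment> \<open>Minimality is used for \<open>?v\<close> here and for
              \<open>\<phi> 2 z\<close> below, so that only \<open>?S\<close> survives modulo
              \<mm>.\<close>
            have "const_coeff ?v e' = 0" for e'
              using y by (intro const_coeff_\<phi>) (simp add: numeral_2_eq_2)
            hence "const_coeff (lext smult x ?v) e = 0"
              by (rule const_coeff_lext)
            moreover have "y = \<phi> 2 z + ?S + lext smult x ?v"
              by (simp add: z(2))
            hence "const_coeff y e = const_coeff (\<phi> 2 z + ?S + lext smult x ?v) e"
              by (rule arg_cong)
            ultimately show ?thesis
              using const_coeff_\<phi>[OF z(1), of e]
              unfolding const_coeff_add const_coeff_sum const_coeff_smult by simp
          qed
          thus "\<exists>s :: nat \<Rightarrow> nat \<Rightarrow> nat \<Rightarrow> 'k.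
              \<forall>e. const_coeff y e = (\<Sum>k<t. \<Sum>j<k. \<Sum>i<j. s i j k * const_coeff (W i j k) e)"
            by (intro exI[of _ "\<lambda>i j k. lookup (s i j k) 0"] allI)
        qed
      qed (rule W(1))
    qed
  qed
qed

end

text \<open>The Betti number is the dimension of the degree \<open>a\<close> part of F_2 / \<mm>
  F_2, modelled by the first \<open>\<beta> 2 a\<close> coordinates of
  \<open>nat \<Rightarrow>\<^sub>0 'k\<close>. The standard basis there is independent and lies in
  the span of the classes of the lifts; a lift of another degree has class zero.\<close>

lemma (in generated_resolution) betti_2_le:
  "\<beta> 2 a \<le> card {(i, j, k). i < j \<and> j < k \<and> k < t \<and> int (mdeg (lcm3 i j k)) = a}"
proof -
  let ?T = "{(i, j, k). i < j \<and> j < k \<and> k < t \<and> int (mdeg (lcm3 i j k)) = a}"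
  let ?b = "\<beta> 2 a"
  let ?scale = "\<lambda>c :: 'k. Poly_Mapping.map ((*) c) :: (nat \<Rightarrow>\<^sub>0 'k) \<Rightarrow> _"
  have scale: "lookup (?scale c v) l = c * lookup v l" for c v l
    by (simp add: map.rep_eq when_def)
  interpret vs: vector_space ?scale
    by standard (rule poly_mapping_eqI; simp add: scale lookup_add algebra_simps)+
  have finite: "finite ?T"
    by (rule finite_subset[of _ "{..<t} \<times> {..<t} \<times> {..<t}"]) auto
  show ?thesis
  proof (rule second_syzygies_generated)
    fix W :: "nat \<Rightarrow> nat \<Rightarrow> nat \<Rightarrow> ('n, 'k) fvec"
    assume W: "\<And>i j k. i < t \<Longrightarrow> j < t \<Longrightarrow> k < t \<Longrightarrow>
      W i j k \<in> free_mod_comp (\<beta> 2) (int (mdeg (lcm3 i j k)))"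
    assume gen: "\<And>y :: ('n, 'k) fvec. y \<in> free_mod (\<beta> 2) \<Longrightarrow> \<exists>s :: nat \<Rightarrow> nat \<Rightarrow> nat \<Rightarrow> 'k.
      \<forall>e. const_coeff y e = (\<Sum>k<t. \<Sum>j<k. \<Sum>i<j. s i j k * const_coeff (W i j k) e)"
    \<comment> \<open>The class of \<open>W i j k\<close> in the degree \<open>a\<close> part of F_2
      / \<mm> F_2.\<close>
    define w where "w i j k = (\<Sum>l<?b. Poly_Mapping.single l (const_coeff (W i j k) (a, l)))" for i j k
    have lookup_w: "lookup (w i j k) l = (if l < ?b then const_coeff (W i j k) (a, l) else 0)" for i j k l
    proof -
      have "lookup (w i j k) l = (\<Sum>l'<?b. if l' = l then const_coeff (W i j k) (a, l') else 0)"
        by (simp add: w_def lookup_sum lookup_single when_def)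
      thus ?thesis by simp
    qed
    let ?B = "(\<lambda>(i, j, k). w i j k) ` ?T"
    let ?U = "(\<lambda>l. Poly_Mapping.single l (1 :: 'k)) ` {..<?b}"
    have w_in: "w i j k \<in> vs.span ?B" if "i < j" "j < k" "k < t" for i j k
    proof (cases "int (mdeg (lcm3 i j k)) = a")
      case True
      with that show ?thesis by (intro vs.span_base) force
    next
      case False
      have "const_coeff (W i j k) (a, l) = 0" for l
        using const_coeff_free_mod_comp[OF W, of i j k "(a, l)"] False that by auto
      hence "w i j k = 0"
        by (intro poly_mapping_eqI) (simp add: lookup_w)
      thus ?thesis by (simp add: vs.span_zero)
    qed
    have "Poly_Mapping.single l 1 \<in> vs.span ?B" if l: "l < ?b" for l
    proof -
      have "(unit_vec (a, l) :: ('n, 'k) fvec) \<in> free_mod (\<beta> 2)"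
        using l by (simp add: free_mod_def)
      then obtain s where s: "\<forall>e. const_coeff (unit_vec (a, l) :: ('n, 'k) fvec) e
          = (\<Sum>k<t. \<Sum>j<k. \<Sum>i<j. s i j k * const_coeff (W i j k) e)"
        using gen by blast
      have "Poly_Mapping.single l 1 = (\<Sum>k<t. \<Sum>j<k. \<Sum>i<j. ?scale (s i j k) (w i j k))"
      proof (rule poly_mapping_eqI)
        fix l'
        have "const_coeff (unit_vec (a, l) :: ('n, 'k) fvec) (a, l') = lookup (Poly_Mapping.single l 1) l'"
          by (auto simp: const_coeff_def lookup_single when_def)
        with s l show "lookup (Poly_Mapping.single l 1) l'
            = lookup (\<Sum>k<t. \<Sum>j<k. \<Sum>i<j. ?scale (s i j k) (w i j k)) l'"
          by (cases "l' < ?b") (auto simp: lookup_sum scale lookup_w lookup_single when_def)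
      qed
      thus ?thesis
        by (auto intro!: vs.span_sum vs.span_scale w_in)
    qed
    hence "?U \<subseteq> vs.span ?B" by auto
    moreover have "vs.independent ?U"
      unfolding vs.dependent_def
    proof safe
      fix l assume "Poly_Mapping.single l 1 \<in> vs.span (?U - {Poly_Mapping.single l 1})"
      moreover have "vs.span (?U - {Poly_Mapping.single l 1}) \<subseteq> {v. lookup v l = 0}"
      proof (rule vs.span_minimal)
        show "vs.subspace {v. lookup v l = 0}"
          by (rule vs.subspaceI) (simp_all add: lookup_add scale)
      qed (auto simp: lookup_single when_def)
      ultimately have "lookup (Poly_Mapping.single l (1 :: 'k)) l = 0" by blast
      thus False by simp
    qed
    ultimately have "card ?U \<le> card ?B"
      using vs.independent_span_bound finite by blast
    also have "\<dots> \<le> card ?T"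
      by (rule card_image_le) (rule finite)
    also have "card ?U = ?b"
      by (subst card_image) (auto intro!: inj_onI simp: poly_mapping_eq_iff fun_eq_iff lookup_single when_def
          split: if_splits)
    finally show ?thesis .
  qed
qed

section \<open>Triples spanning exactly two edges\<close>

locale finite_graph =
  fixes V :: "'a set" and adj :: "'a \<Rightarrow> 'a \<Rightarrow> bool"
  assumes finite_V: "finite V" and sym: "adj x y \<longleftrightarrow> adj y x"
begin

definition nb :: "'a \<Rightarrow> 'a set" where
  "nb x = {y \<in> V. y \<noteq> x \<and> adj x y}"

definition conb :: "'a \<Rightarrow> 'a set" where
  "conb x = {y \<in> V. y \<noteq> x \<and> \<not> adj x y}"

text \<open>The centre comes first and the two ends in either order, so each triple with exactly two
  edges is counted twice.\<close>

definition cherries :: "('a \<times> 'a \<times> 'a) set" where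
  "cherries = {(x, y, z). x \<in> V \<and> y \<in> nb x \<and> z \<in> nb x \<and> y \<noteq> z \<and> \<not> adj y z}"

text \<open>Triples with exactly one edge, with either end of that edge first, so again counted
  twice.\<close>

definition cocherries :: "('a \<times> 'a \<times> 'a) set" where
  "cocherries = {(x, y, z). x \<in> V \<and> y \<in> nb x \<and> z \<in> conb x \<and> \<not> adj y z}"

lemma finite_nb [simp]: "finite (nb x)" "finite (conb x)"
  using finite_V by (simp_all add: nb_def conb_def)

lemma finite_cocherries: "finite cocherries"
  by (rule finite_subset[of _ "V \<times> V \<times> V"]) (auto simp: cocherries_def nb_def conb_def finite_V)

lemma finite_cherries: "finite cherries"
  by (rule finite_subset[of _ "V \<times> V \<times> V"]) (auto simp: cherries_def nb_def finite_V)

lemma card_conb: "x \<in> V \<Longrightarrow> card (nb x) + card (conb x) + 1 = card V"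
proof -
  assume x: "x \<in> V"
  have "V = insert x (nb x \<union> conb x)" "x \<notin> nb x \<union> conb x" "nb x \<inter> conb x = {}"
    using x by (auto simp: nb_def conb_def)
  thus ?thesis
    by (metis (no_types, lifting) Suc_eq_plus1 card_Un_disjoint card_insert_disjoint finite_UnI finite_nb)
qed

text \<open>Goodman's identity: both sides count the pairs of an edge and a non-edge that share a vertex.\<close>

lemma card_cherries_cocherries:
  "card cherries + card cocherries = (\<Sum>x\<in>V. card (nb x) * card (conb x))"
proof -
  \<comment> \<open>An edge \<open>x y\<close> and a non-edge \<open>x z\<close> form a cherry with
    centre \<open>y\<close> if \<open>y z\<close> is an edge, and a cocherry otherwise.\<close>
  let ?M = "{(x, y, z). x \<in> V \<and> y \<in> nb x \<and> z \<in> conb x \<and> adj y z}"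
  have "bij_betw (\<lambda>(x, y, z). (y, x, z)) ?M cherries"
    by (rule bij_betw_byWitness[where f' = "\<lambda>(x, y, z). (y, x, z)"])
      (auto simp: cherries_def nb_def conb_def sym)
  hence "card cherries = card ?M"
    by (simp add: bij_betw_same_card)
  moreover have "(SIGMA x : V. nb x \<times> conb x) = ?M \<union> cocherries" "?M \<inter> cocherries = {}"
    by (auto simp: cocherries_def)
  moreover have "finite ?M"
    by (rule finite_subset[of _ "V \<times> V \<times> V"]) (auto simp: nb_def conb_def finite_V)
  ultimately have "card cherries + card cocherries = card (SIGMA x : V. nb x \<times> conb x)"
    using finite_cocherries by (simp add: card_Un_disjoint)
  thus ?thesis
    using finite_V by (simp add: card_cartesian_product)
qed

lemma int_card_cherries_cocherries:
  "int (card cherries) + int (card cocherries) = (\<Sum>x\<in>V. int (card (nb x) * card (conb x)))"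
  by (simp only: of_nat_add[symmetric] of_nat_sum[symmetric] card_cherries_cocherries)

lemma card_cherries_even:
  assumes "card V = 2 * u"
  shows "int (card cherries) \<le> 2 * int u * (int u * (int u - 1))"
proof -
  have "int (card (nb x) * card (conb x)) \<le> int u * (int u - 1)" if "x \<in> V" for x
  proof -
    have *: "int (card (conb x)) = 2 * int u - 1 - int (card (nb x))"
      using card_conb[OF that] assms by linarith
    \<comment> \<open>For a degree a and codegree 2u - 1 - a, the gap between u(u - 1) and their
      product is (a - u)(a - u + 1), a product of consecutive integers.\<close>
    have "0 \<le> (int (card (nb x)) - int u) * (int (card (nb x)) - int u + 1)"
      by (cases "int (card (nb x)) \<ge> int u") (auto intro: mult_nonneg_nonneg mult_nonpos_nonpos)
    thus ?thesis
      unfolding of_nat_mult * by (simp add: algebra_simps)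
  qed
  hence "(\<Sum>x\<in>V. int (card (nb x) * card (conb x))) \<le> (\<Sum>x\<in>V. int u * (int u - 1))"
    by (rule sum_mono)
  moreover have "int (card cherries) \<le> (\<Sum>x\<in>V. int (card (nb x) * card (conb x)))"
    unfolding int_card_cherries_cocherries[symmetric] by simp
  ultimately show ?thesis
    using assms by simp
qed

text \<open>Goodman's bound alone is not sharp for odd order. If few degrees differ from \<open>u\<close>, then the
  neighbours of a vertex of degree \<open>u\<close> miss many of its non-neighbours, which yields triples with
  exactly one edge.\<close>

lemma card_cherries_odd:
  assumes "card V = 2 * u + 1"
  shows "int (card cherries) \<le> (2 * int u + 1) * int u ^ 2 - int u"
proof -
  define D where "D x = int (card (nb x)) - int u" for x
  have prod_eq: "int (card (nb x) * card (conb x)) = int u ^ 2 - D x ^ 2" if "x \<in> V" for x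
  proof -
    have *: "int (card (conb x)) = 2 * int u - int (card (nb x))"
      using card_conb[OF that] assms by linarith
    thus ?thesis
      unfolding of_nat_mult * by (simp add: D_def power2_eq_square algebra_simps)
  qed
  have "int (card cherries) + int (card cocherries) = (\<Sum>x\<in>V. int (card (nb x) * card (conb x)))"
    by (rule int_card_cherries_cocherries)
  also have "\<dots> = (2 * int u + 1) * int u ^ 2 - (\<Sum>x\<in>V. D x ^ 2)"
    using assms by (simp add: prod_eq sum_subtractf del: of_nat_mult)
  finally have total: "int (card cherries) + int (card cocherries)
    = (2 * int u + 1) * int u ^ 2 - (\<Sum>x\<in>V. D x ^ 2)" .
  \<comment> \<open>The required loss of \<open>u\<close> comes from nonzero deviations
    \<open>D\<close> or from cocherries. If every \<open>D x\<close> is nonzero, the squares alone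
    give 2u + 1; otherwise a vertex \<open>v\<close> of degree \<open>u\<close> is examined.\<close>
  have "int u \<le> int (card cocherries) + (\<Sum>x\<in>V. D x ^ 2)"
  proof (cases "\<exists>v\<in>V. D v = 0")
    case False
    hence "1 \<le> D x ^ 2" if "x \<in> V" for x
      using that by (simp add: int_one_le_iff_zero_less)
    hence "(\<Sum>x\<in>V. 1) \<le> (\<Sum>x\<in>V. D x ^ 2)"
      by (rule sum_mono)
    thus ?thesis using assms by simp
  next
    case True
    then obtain v where v: "v \<in> V" "D v = 0" by blast
    have card_v: "card (nb v) = u" "card (conb v) = u"
      using v card_conb[OF v(1)] assms by (simp_all add: D_def)
    let ?e = "\<lambda>x. card {z \<in> conb v. \<not> adj x z}"
    \<comment> \<open>A neighbour \<open>x\<close> of \<open>v\<close> has degree u +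
      \<open>D x\<close> and spends one edge on \<open>v\<close>, so it misses at least 1 -
      \<open>D x\<close> of the u non-neighbours of \<open>v\<close>. Each miss is a cocherry
      starting at \<open>v\<close>. Since \<open>D x\<close> is an integer, it is at most its
      square.\<close>
    have "1 - D x ^ 2 \<le> int (?e x)" if x: "x \<in> nb v" for x
    proof -
      have "insert v {z \<in> conb v. adj x z} \<subseteq> nb x"
        using x v by (auto simp: nb_def conb_def sym)
      hence "card (insert v {z \<in> conb v. adj x z}) \<le> card (nb x)"
        by (rule card_mono[rotated]) simp
      moreover have "v \<notin> conb v" by (simp add: conb_def)
      ultimately have "1 + card {z \<in> conb v. adj x z} \<le> card (nb x)"
        by simp
      moreover have "card {z \<in> conb v. adj x z} + ?e x = u"
      proof -
        have "conb v = {z \<in> conb v. adj x z} \<union> {z \<in> conb v. \<not> adj x z}" by blast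
        moreover have "card ({z \<in> conb v. adj x z} \<union> {z \<in> conb v. \<not> adj x z})
            = card {z \<in> conb v. adj x z} + ?e x"
          by (rule card_Un_disjoint) auto
        ultimately show ?thesis using card_v by simp
      qed
      ultimately have "1 - D x \<le> int (?e x)"
        by (simp add: D_def)
      moreover have "D x \<le> D x ^ 2"
        using self_le_power[of "D x" 2]
        by (cases "D x \<ge> 1") (auto intro: order_trans[OF _ zero_le_power2])
      ultimately show ?thesis by linarith
    qed
    hence "(\<Sum>x\<in>nb v. 1 - D x ^ 2) \<le> (\<Sum>x\<in>nb v. int (?e x))"
      by (rule sum_mono)
    moreover have "(\<Sum>x\<in>nb v. D x ^ 2) \<le> (\<Sum>x\<in>V. D x ^ 2)"
      by (rule sum_mono2) (auto simp: finite_V nb_def)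
    moreover have "(\<Sum>x\<in>nb v. int (?e x)) \<le> int (card cocherries)"
    proof -
      have "{v} \<times> (SIGMA x : nb v. {z \<in> conb v. \<not> adj x z}) \<subseteq> cocherries"
        using v by (auto simp: cocherries_def)
      hence "card ({v} \<times> (SIGMA x : nb v. {z \<in> conb v. \<not> adj x z})) \<le> card cocherries"
        by (rule card_mono[OF finite_cocherries])
      thus ?thesis by (simp add: card_cartesian_product flip: of_nat_sum)
    qed
    ultimately show ?thesis
      by (simp add: sum_subtractf card_v)
  qed
  with total show ?thesis by linarith
qed

end

text \<open>Over the integers the product formula also covers \<open>n < 3\<close>, where both sides
  vanish.\<close>

lemma six_choose_three: "6 * int (n choose 3) = int n * (int n - 1) * (int n - 2)"
proof (induction n)
  case (Suc n)
  have two: "2 * int (n choose 2) = int n * (int n - 1)"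
  proof (induction n)
    case (Suc n)
    thus ?case by (simp add: numeral_2_eq_2 algebra_simps)
  qed simp
  have "Suc n choose 3 = (n choose 2) + (n choose 3)"
    by (simp add: numeral_3_eq_3 numeral_2_eq_2)
  with Suc two show ?case by (simp add: algebra_simps)
qed simp

lemma card_two_edge_triples:
  fixes adj :: "nat \<Rightarrow> nat \<Rightarrow> bool" and t1 t2 :: int
  assumes sym: "\<And>x y. adj x y \<longleftrightarrow> adj y x" and t: "t1 + t2 = int t" "\<bar>t1 - t2\<bar> \<le> 1"
  shows "int (card {(i, j, k). i < j \<and> j < k \<and> k < t \<and>
      (adj i j \<and> adj i k \<and> \<not> adj j k \<or> adj i j \<and> \<not> adj i k \<and> adj j k \<or> \<not> adj i j \<and> adj i k \<and> adj j k)})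
    \<le> int (t choose 3) - int (nat t1 choose 3) - int (nat t2 choose 3)"
    (is "int (card ?C) \<le> _")
proof -
  interpret finite_graph "{..<t}" adj
    by standard (simp_all add: sym)
  \<comment> \<open>\<open>?c\<close> moves the centre to the front and keeps the ends increasing;
    the Boolean in \<open>?f\<close> decides whether to swap them. Sorting the entries and comparing
    the ends recovers the triple and the Boolean.\<close>
  let ?c = "\<lambda>(i, j, k). if adj i j \<and> adj i k then (i, j, k) else if adj i j then (j, i, k) else (k, i, j)"
  let ?f = "\<lambda>(s, b). case ?c s of (x, y, z) \<Rightarrow> if b then (x, y, z) else (x, z, y)"
  have "inj_on ?f (?C \<times> UNIV)"
    by (rule inj_onI) (auto split: if_splits)
  moreover have "?f ` (?C \<times> UNIV) \<subseteq> cherries"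
    by (auto simp: cherries_def nb_def sym split: if_splits)
  ultimately have "card (?C \<times> (UNIV :: bool set)) \<le> card cherries"
    using finite_cherries by (rule card_inj_on_le)
  hence C: "2 * int (card ?C) \<le> int (card cherries)"
    by (simp add: card_cartesian_product)
  \<comment> \<open>Near evenness and a nonnegative sum force both parts to be nonnegative, so
    \<open>nat\<close> loses nothing. In the odd case either part may be the larger one.\<close>
  consider u where "t = 2 * u" "t1 = int u" "t2 = int u"
    | u where "t = 2 * u + 1" "nat t1 = u \<and> nat t2 = u + 1 \<or> nat t1 = u + 1 \<and> nat t2 = u"
  proof (cases "even t")
    case True
    then obtain u where "t = 2 * u" by blast
    with t that(1)[of u] show thesis by linarith
  next
    case False
    then obtain u where "t = 2 * u + 1" by (rule oddE)
    with t that(2)[of u] show thesis by linarith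
  qed
  thus ?thesis
  proof cases
    case 1
    have "int (card cherries) \<le> 2 * int u * (int u * (int u - 1))"
      using 1 by (intro card_cherries_even) simp
    \<comment> \<open>The factor 3, with the double count of each triple, gives the 6 of
      \<open>six_choose_three\<close>.\<close>
    hence "3 * int (card cherries) \<le> 3 * (2 * int u * (int u * (int u - 1)))"
      by (rule mult_left_mono) simp
    also have "\<dots> = 6 * (int (t choose 3) - int (nat t1 choose 3) - int (nat t2 choose 3))"
      using 1 six_choose_three[of t] six_choose_three[of u] by (simp add: algebra_simps)
    finally show ?thesis using C by simp
  next
    case 2
    have "int (card cherries) \<le> (2 * int u + 1) * int u ^ 2 - int u"
      using 2 by (intro card_cherries_odd) simp
    hence "3 * int (card cherries) \<le> 3 * ((2 * int u + 1) * int u ^ 2 - int u)"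
      by (rule mult_left_mono) simp
    also have "\<dots> = 6 * (int (t choose 3) - int (u choose 3) - int ((u + 1) choose 3))"
      using 2 six_choose_three[of t] six_choose_three[of u] six_choose_three[of "u + 1"]
      by (simp add: algebra_simps power2_eq_square)
    finally show ?thesis using 2 C by auto
  qed
qed

section \<open>Least common multiples of degree \<open>3d - 1\<close>\<close>

lemma mdeg_squarefree:
  assumes "squarefree_monom m"
  shows "mdeg m = card (keys m)"
proof -
  have "lookup m x = (if x \<in> keys m then 1 else 0)" for x
    using assms le_Suc_eq[of "lookup m x" 0] by (auto simp: squarefree_monom_def in_keys_iff)
  thus ?thesis by (simp add: mdeg_def sum.If_cases)
qed

lemma keys_mlcm: "keys (mlcm l m) = keys l \<union> keys m"
  by (auto simp: in_keys_iff lookup_mlcm max_def split: if_splits)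

lemma squarefree_mlcm: "squarefree_monom l \<Longrightarrow> squarefree_monom m \<Longrightarrow> squarefree_monom (mlcm l m)"
  by (simp add: squarefree_monom_def lookup_mlcm)

text \<open>Adding the sets one at a time loses \<open>card (A \<inter> B)\<close> and then
  \<open>card ((A \<union> B) \<inter> C)\<close> from 3d, so these sum to one. An element of all
  three sets would be lost twice, hence the single lost element belongs to just one pair.\<close>

lemma exactly_one_pair_meets:
  assumes "finite A" "finite B" "finite C" "card A = d" "card B = d" "card C = d"
    and card: "int (card (A \<union> (B \<union> C))) = 3 * int d - 1"
  shows "A \<inter> B = {} \<and> A \<inter> C = {} \<and> B \<inter> C \<noteq> {} \<or> A \<inter> B = {} \<and> A \<inter> C \<noteq> {} \<and> B \<inter> C = {} \<or>
    A \<inter> B \<noteq> {} \<and> A \<inter> C = {} \<and> B \<inter> C = {}"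
proof -
  have AB: "card (A \<union> B) + card (A \<inter> B) = 2 * d"
    using card_Un_Int[of A B] assms by simp
  have "card (A \<union> B \<union> C) + card ((A \<union> B) \<inter> C) = card (A \<union> B) + d"
    using card_Un_Int[of "A \<union> B" C] assms by simp
  moreover have "card (A \<union> B \<union> C) = card (A \<union> (B \<union> C))"
    by (simp add: Un_assoc)
  ultimately have sum: "card (A \<inter> B) + card ((A \<union> B) \<inter> C) = 1"
    using AB card by linarith
  show ?thesis
  proof (cases "A \<inter> B = {}")
    case False
    hence "card (A \<inter> B) \<noteq> 0" using assms by simp
    with sum have "card ((A \<union> B) \<inter> C) = 0" by linarith
    hence "(A \<union> B) \<inter> C = {}" using assms by simp
    with False show ?thesis by blast
  next
    case True
    have "card ((A \<union> B) \<inter> C) = card (A \<inter> C) + card (B \<inter> C)"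
      unfolding Int_Un_distrib2 using True assms by (intro card_Un_disjoint) auto
    with sum True have "card (A \<inter> C) = 0 \<and> card (B \<inter> C) \<noteq> 0 \<or> card (A \<inter> C) \<noteq> 0 \<and> card (B \<inter> C) = 0"
      by (auto simp: add_is_1)
    with True assms show ?thesis by simp
  qed
qed

theorem theorem4p1:
  fixes I :: "('n::finite, 'k::field) mpoly set"
    and d t :: nat
    and t1 t2 :: int
    and \<beta> :: "nat \<Rightarrow> int \<Rightarrow> nat"
  assumes "d \<ge> 1"
    and "t \<ge> 1"
    and "pure_squarefree_monomial_ideal d I"
    and "card (min_mon_gens I) = t"
    and "nearly_even_2_partition (int t) (t1, t2)"
    and "graded_betti_numbers I \<beta>"
  shows "int (\<beta> 2 (3 * int d - 1)) \<le>
           int (t choose 3) - int (nat t1 choose 3) - int (nat t2 choose 3)"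
proof -
  let ?G = "min_mon_gens I"
  have ideal: "monomial_ideal I" and gens: "\<And>l. l \<in> ?G \<Longrightarrow> squarefree_monom l \<and> mdeg l = d"
    using assms(3) by (auto simp: pure_squarefree_monomial_ideal_def)
  \<comment> \<open>An infinite set has \<open>card\<close> zero, so \<open>t \<ge> 1\<close> yields
    finiteness.\<close>
  have finite: "finite ?G"
    using assms(2,4) by (intro card_ge_0_finite) simp
  then obtain m where m: "bij_betw m {..<t} ?G"
    using ex_bij_betw_nat_finite[of ?G] assms(4) by (auto simp: lessThan_atLeast0)
  obtain \<epsilon> \<phi> where res: "minimal_graded_free_resolution I \<beta> \<epsilon> \<phi>"
    using assms(6) by (auto simp: graded_betti_numbers_def)
  have m_in: "m i \<in> ?G" if "i < t" for i
    using bij_betwE[OF m] that by simp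
  interpret generated_resolution I \<beta> \<epsilon> \<phi> m t
  proof
    show "minimal_graded_free_resolution I \<beta> \<epsilon> \<phi>" by (rule res)
    show "mon (m i) \<in> I" if "i < t" for i
      using m_in[OF that] by (simp add: min_mon_gens_def)
    fix p assume "p \<in> I"
    from monomial_ideal_representation[OF ideal this finite] obtain u
      where "p = (\<Sum>l\<in>?G. u l * mon l)" .
    hence "p = (\<Sum>i<t. u (m i) * mon (m i))"
      by (simp only: sum.reindex_bij_betw[OF m, of "\<lambda>l. u l * mon l"])
    thus "\<exists>u. p = (\<Sum>i<t. u i * mon (m i))"
      by (rule exI[of _ "\<lambda>i. u (m i)"])
  qed
  define adj where "adj i j \<longleftrightarrow> keys (m i) \<inter> keys (m j) = {}" for i j
  let ?E = "{(i, j, k). i < j \<and> j < k \<and> k < t \<and> (adj i j \<and> adj i k \<and> \<not> adj j k \<or>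
    adj i j \<and> \<not> adj i k \<and> adj j k \<or> \<not> adj i j \<and> adj i k \<and> adj j k)}"
  have key: "adj i j \<and> adj i k \<and> \<not> adj j k \<or> adj i j \<and> \<not> adj i k \<and> adj j k \<or>
      \<not> adj i j \<and> adj i k \<and> adj j k"
    if ijk: "i < j" "j < k" "k < t" and deg: "int (mdeg (lcm3 i j k)) = 3 * int d - 1" for i j k
  proof -
    have *: "squarefree_monom (m l) \<and> card (keys (m l)) = d" if "l < t" for l
      using gens[OF m_in[OF that]] mdeg_squarefree by metis
    have "mdeg (lcm3 i j k) = card (keys (m i) \<union> (keys (m j) \<union> keys (m k)))"
      using ijk * by (simp add: lcm3_def mdeg_squarefree squarefree_mlcm keys_mlcm)
    with deg ijk * show ?thesis
      unfolding adj_def by (intro exactly_one_pair_meets) auto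
  qed
  have "{(i, j, k). i < j \<and> j < k \<and> k < t \<and> int (mdeg (lcm3 i j k)) = 3 * int d - 1} \<subseteq> ?E"
    using key by blast
  moreover have "finite ?E"
    by (rule finite_subset[of _ "{..<t} \<times> {..<t} \<times> {..<t}"]) auto
  ultimately have "\<beta> 2 (3 * int d - 1) \<le> card ?E"
    by (intro order_trans[OF betti_2_le card_mono])
  also have "int (card ?E) \<le> int (t choose 3) - int (nat t1 choose 3) - int (nat t2 choose 3)"
    using assms(5) by (intro card_two_edge_triples) (auto simp: adj_def nearly_even_2_partition_def)
  finally show ?thesis by simp
qed

end
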